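(* If $O$ is an lsp-operation, then $\mathcal D(O)=(\mathcal D_O,m_{01},m_{02},m_{12})$ is the Delaney–Dress symbol of a tiling of the Euclidean plane, i.e. it is a Delaney–Dress symbol of the Euclidean plane.
   Context: **lsp-operations.** Graphs are finite and may have multiple edges. An embedded graph is a connected graph with a cyclic order of the oriented edges at every vertex; it is plane if its genus is 0. An lsp-operation is a 2-connected plane embedded graph $O$ with a labelling $t:V_O\to\{0,1,2\}$ ($t(v)$ is the type of $v$) and an outer face containing three distinct special vertices $v_0,v_1,v_2$ such that: 1. every inner face (i.e. face other than the outer face) is a triangle; 2. no edge joins vertices of the same type; 3. every vertex of type 1 not in the outer face has degree 4; every vertex of type 1 in the outer face different from $v_0,v_1,v_2$ has degree 3; $t(v_0)\ne1$ and $t(v_2)\neq1$; if $t(v_1)=1$ then $\deg(v_1)=2$. An edge is of type $i$ (an $i$-edge) if it is not incident with a vertex of type $i$. Every inner face has exactly one vertex and one edge of each type and is called a chamber. **Delaney–Dress symbols.** Let $\Sigma=\langle\sigma_0,\sigma_1,\sigma_2\mid\sigma_i^2=1\rangle$. Let $\mathcal D$ be a set with a right action of $\Sigma$ and, for $(i,j)\in\{(0,1),(0,2),(1,2)\}$, let $m_{ij}:\mathcal D\to\mathbb N$ be maps with $m_{02}(C)=2$ for all $C\in\mathcal D$. The tuple $(\mathcal D,m_{01},m_{02},m_{12})$ is a Delaney–Dress symbol of the Euclidean plane if 1. $\mathcal D$ is finite; 2. $\Sigma$ acts transitively on $\mathcal D$; 3. for $i<j$, $m_{ij}$ is constant on $\langle\sigma_i,\sigma_j\rangle$-orbits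 and $C(\sigma_i\sigma_j)^{m_{ij}(C)}=C$ for all $C\in\mathcal D$; 4. the curvature vanishes: $\sum_{C\in\mathcal D}\left(\frac1{m_{01}(C)}+\frac1{m_{12}(C)}-\frac1{m_{02}(C)}\right)=0$. Such symbols encode periodic tilings of the Euclidean plane. **The symbol $\mathcal D(O)$.** $\mathcal D_O$ is the set of chambers of $O$; $C\sigma_i=C'$ if $C\neq C'$ share their $i$-edge, and $C\sigma_i=C$ if $C$ shares its $i$-edge with the outer face. For $i<j$ let $v^{ij}(C)$ be the vertex of $C$ that is not of type $i$ or $j$, and let $n_{ij}(C)=|C^{\langle\sigma_i,\sigma_j\rangle}|$ be the size of the $\langle\sigma_i,\sigma_j\rangle$-orbit of $C$. Then $$m_{ij}(C)=\begin{cases}2\,n_{ij}(C)&\text{if }v^{ij}(C)=v_1,\\3\,n_{ij}(C)&\text{if }v^{ij}(C)=v_0,\\6\,n_{ij}(C)&\text{if }v^{ij}(C)=v_2,\\ n_{ij}(C)/2&\text{if }v^{ij}(C)\text{ is not in the outer face},\\ n_{ij}(C)&\text{if }v^{ij}(C)\text{ is in the outer face and different from }v_0,v_1,v_2.\end{cases}$$ *)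

theory Defs
  imports
    Complex_Main
    "HOL-Combinatorics.Orbits"
    "Graph_Theory.Digraph_Component"
    "Graph_Theory.Bidirected_Digraph"
begin

section \<open>Embedded graphs\<close>

text \<open>
  A finite multigraph is represented by its oriented edges: every edge is a pair of arcs
  \<open>a\<close>, \<open>arev a\<close>. The cyclic order at a vertex \<open>v\<close> is the restriction of the permutation
  \<open>asucc\<close> to the arcs leaving \<open>v\<close>.
\<close>

locale embedded_graph =
  fin_digraph G + bidirected_digraph G arev
  for G :: "('v, 'a) pre_digraph" and arev :: "'a \<Rightarrow> 'a" +
  fixes asucc :: "'a \<Rightarrow> 'a"
  assumes connected: "Digraph_Component.connected G"
    and asucc_permutes: "asucc permutes arcs G"
    and asucc_cyclic: "\<And>v. v \<in> verts G \<Longrightarrow> out_arcs G v \<noteq> {} \<Longrightarrow> cyclic_on asucc (out_arcs G v)"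
begin

definition edges :: "'a set set" where
  "edges = (\<lambda>a. {a, arev a}) ` arcs G"

text \<open>
  A face is the set of arcs traversed when, on reaching the end of an arc \<open>a\<close>, one continues
  with the arc following \<open>arev a\<close>. (The graph with one vertex and no edge gets no face.)
\<close>

definition faces :: "'a set set" where
  "faces = orbit (asucc \<circ> arev) ` arcs G"

definition face_verts :: "'a set \<Rightarrow> 'v set" where
  "face_verts f = tail G ` f"

definition has_genus :: "nat \<Rightarrow> bool" where
  "has_genus g \<longleftrightarrow> int (card (verts G)) - int (card edges) + int (card faces) = 2 - 2 * int g"

definition plane :: bool where
  "plane \<longleftrightarrow> has_genus 0"

definition two_connected :: bool where
  "two_connected \<longleftrightarrow> card (verts G) > 2 \<and>
     (\<forall>v\<in>verts G. Digraph_Component.connected (pre_digraph.del_vert G v))"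

end


section \<open>Lsp-operations and the associated symbol\<close>

text \<open>
  Every edge contributes one arc leaving each of its ends, so \<open>out_degree G v\<close> is the degree
  of \<open>v\<close>.
\<close>

locale lsp_operation = embedded_graph G arev asucc
  for G :: "('v, 'a) pre_digraph" and arev :: "'a \<Rightarrow> 'a" and asucc :: "'a \<Rightarrow> 'a" +
  fixes t :: "'v \<Rightarrow> nat" and outer :: "'a set" and v0 v1 v2 :: 'v
  assumes plane: plane
    and two_connected: two_connected
    and type_range: "\<And>v. v \<in> verts G \<Longrightarrow> t v \<in> {0, 1, 2}"
    and outer_face: "outer \<in> faces"
    and special_outer: "{v0, v1, v2} \<subseteq> face_verts outer"
    and special_distinct: "v0 \<noteq> v1" "v0 \<noteq> v2" "v1 \<noteq> v2"
    and inner_triangle: "\<And>f. f \<in> faces \<Longrightarrow> f \<noteq> outer \<Longrightarrow> card f = 3"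
    and type_proper: "\<And>a. a \<in> arcs G \<Longrightarrow> t (tail G a) \<noteq> t (head G a)"
    and type1_inner: "\<And>v. v \<in> verts G \<Longrightarrow> t v = 1 \<Longrightarrow> v \<notin> face_verts outer \<Longrightarrow> out_degree G v = 4"
    and type1_outer: "\<And>v. t v = 1 \<Longrightarrow> v \<in> face_verts outer \<Longrightarrow> v \<notin> {v0, v1, v2} \<Longrightarrow> out_degree G v = 3"
    and type_v0: "t v0 \<noteq> 1"
    and type_v2: "t v2 \<noteq> 1"
    and type_v1: "t v1 = 1 \<Longrightarrow> out_degree G v1 = 2"

text \<open>
  An action of the free product \<open>\<langle>\<sigma>\<^sub>0, \<sigma>\<^sub>1, \<sigma>\<^sub>2 | \<sigma>\<^sub>i\<^sup>2 = 1\<rangle>\<close> is given by the maps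
  \<open>\<sigma> i\<close> (\<open>i \<in> {0, 1, 2}\<close>) by which the generators act, the only condition being that they are
  involutions. Elements of the subgroup generated by the \<open>\<sigma>\<^sub>i\<close> with \<open>i \<in> I\<close> are represented
  by words over \<open>I\<close>; as the action is on the right, words are applied from left to right.
\<close>

definition sigma_orbit :: "(nat \<Rightarrow> 'c \<Rightarrow> 'c) \<Rightarrow> nat set \<Rightarrow> 'c \<Rightarrow> 'c set" where
  "sigma_orbit \<sigma> I C = foldl (\<lambda>x i. \<sigma> i x) C ` lists I"

context lsp_operation
begin

definition chambers :: "'a set set" where
  "chambers = faces - {outer}"

definition edge_of_type :: "nat \<Rightarrow> 'a \<Rightarrow> bool" where
  "edge_of_type i a \<longleftrightarrow> t (tail G a) \<noteq> i \<and> t (head G a) \<noteq> i"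

text \<open>The \<open>i\<close>-edge of \<open>C\<close> is shared with a face \<open>f\<close> iff its reverse arc lies on \<open>f\<close>.\<close>

definition shares_edge :: "nat \<Rightarrow> 'a set \<Rightarrow> 'a set \<Rightarrow> bool" where
  "shares_edge i C f \<longleftrightarrow> (\<exists>a\<in>C. edge_of_type i a \<and> arev a \<in> f)"

definition sigma :: "nat \<Rightarrow> 'a set \<Rightarrow> 'a set" where
  "sigma i C = (if shares_edge i C outer then C
                else THE C'. C' \<in> chambers \<and> C' \<noteq> C \<and> shares_edge i C C')"

definition corner :: "nat \<Rightarrow> nat \<Rightarrow> 'a set \<Rightarrow> 'v" where
  "corner i j C = (THE v. v \<in> face_verts C \<and> t v \<noteq> i \<and> t v \<noteq> j)"

definition n :: "nat \<Rightarrow> nat \<Rightarrow> 'a set \<Rightarrow> nat" where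
  "n i j C = card (sigma_orbit sigma {i, j} C)"

text \<open>
  The values are real numbers, so that halving does not round: that they are natural numbers
  is something to be proved.
\<close>

definition m :: "nat \<Rightarrow> nat \<Rightarrow> 'a set \<Rightarrow> real" where
  "m i j C =
    (let v = corner i j C; k = real (n i j C) in
      if v = v1 then 2 * k
      else if v = v0 then 3 * k
      else if v = v2 then 6 * k
      else if v \<notin> face_verts outer then k / 2
      else k)"

end


section \<open>Delaney--Dress symbols of the Euclidean plane\<close>

text \<open>
  Only the values \<open>m i j\<close> with \<open>i < j \<le> 2\<close> are relevant. They are positive, as is implicit in
  the curvature. A transitive action has exactly one orbit, so \<open>D\<close> is nonempty.
\<close>

locale euclidean_delaney_dress_symbol =
  fixes D :: "'c set" and \<sigma> :: "nat \<Rightarrow> 'c \<Rightarrow> 'c" and m :: "nat \<Rightarrow> nat \<Rightarrow> 'c \<Rightarrow> nat"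
  assumes action_closed: "\<And>i C. i \<le> 2 \<Longrightarrow> C \<in> D \<Longrightarrow> \<sigma> i C \<in> D"
    and action_involution: "\<And>i C. i \<le> 2 \<Longrightarrow> C \<in> D \<Longrightarrow> \<sigma> i (\<sigma> i C) = C"
    and m_pos: "\<And>i j C. i < j \<Longrightarrow> j \<le> 2 \<Longrightarrow> C \<in> D \<Longrightarrow> m i j C > 0"
    and m02: "\<And>C. C \<in> D \<Longrightarrow> m 0 2 C = 2"
    and finite: "finite D"
    and nonempty: "D \<noteq> {}"
    and transitive: "\<And>C. C \<in> D \<Longrightarrow> sigma_orbit \<sigma> {0, 1, 2} C = D"
    and m_constant: "\<And>i j C C'. i < j \<Longrightarrow> j \<le> 2 \<Longrightarrow> C \<in> D \<Longrightarrow> C' \<in> sigma_orbit \<sigma> {i, j} C \<Longrightarrow>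
      m i j C' = m i j C"
    and m_power: "\<And>i j C. i < j \<Longrightarrow> j \<le> 2 \<Longrightarrow> C \<in> D \<Longrightarrow> ((\<lambda>x. \<sigma> j (\<sigma> i x)) ^^ m i j C) C = C"
    and curvature: "(\<Sum>C\<in>D. 1 / real (m 0 1 C) + 1 / real (m 1 2 C) - 1 / real (m 0 2 C)) = 0"

end

theory Submission
  imports Defs
begin

text \<open>
  The chambers around a vertex \<open>v\<close> correspond to the arcs leaving \<open>v\<close> that do not lie on the outer
  face, and the two reflections move such an arc to its successor or predecessor around \<open>v\<close>. As
  \<open>G\<close> is plane and 2-connected, the outer face visits each vertex at most once, so these arcs form a
  cycle if \<open>v\<close> is inner and a path otherwise. Hence each corner vertex contributes one orbit, on
  which \<open>1 / m\<close> sums to a constant: \<open>2\<close> for an inner vertex, \<open>1/2\<close>, \<open>1/3\<close>, \<open>1/6\<close> for \<open>v\<^sub>1\<close>, \<open>v\<^sub>0\<close>,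
  \<open>v\<^sub>2\<close>, and \<open>1\<close> for the other outer vertices. Summing over all vertices and using Euler's formula
  gives curvature \<open>0\<close>.
\<close>

section \<open>Cycles of permutations\<close>

text \<open>Planarity is available only as the count V - E + F = 2, not as a drawing. So the
  topological claim that the outer face passes each vertex once has to come from counting cycles of
  permutations: composing with a transposition changes the number of cycles by one, and this yields
  V + F \<le> E + 2k for a map with k components. The constants balance because 1/2 + 1/3 + 1/6 = 1,
  the angle sum of a Euclidean triangle in units of pi. Measured against 2, every outer vertex loses
  1, and the special ones lose a further 1/2, 2/3 and 5/6, together 2. With c chambers, Euler's
  formula reads 2V = |outer| + c + 2, so all weights add up to c; since \<open>m 0 2\<close> is 2,
  reversing the sign of its term removes 2 * (c/2). The delicate value of \<open>m\<close> is the
  one at an inner vertex, half the orbit size: the rotation must return after half the orbit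
  already. This holds because the types of the neighbours alternate around the vertex, which
  2-colours the chambers there so that both reflections flip the colour.\<close>

lemma orbit_subsetI:
  assumes "f x \<in> A" "\<And>y. y \<in> A \<Longrightarrow> f y \<in> A"
  shows "orbit f x \<subseteq> A"
proof
  fix y assume "y \<in> orbit f x"
  then show "y \<in> A" by induct (use assms in auto)
qed

lemma permutes_self_in_orbit:
  assumes "p permutes D" "finite D"
  shows "x \<in> orbit p x"
  using assms permutation_permutes permutation_self_in_orbit by metis

lemma permutes_orbit_eq:
  assumes "p permutes D" "finite D" "y \<in> orbit p x"
  shows "orbit p y = orbit p x"
  using cyclic_on_orbit[OF assms(1,2)] assms(3) by (rule orbit_cyclic_eq3)

lemma orbit_comp_transpose_other:
  assumes "p permutes D" "finite D" "x \<notin> orbit p z" "y \<notin> orbit p z"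
  shows "orbit (p \<circ> transpose x y) z = orbit p z"
  using permutes_self_in_orbit[OF assms(1,2)]
  by (rule orbit_cong) (use assms in \<open>auto simp: transpose_def\<close>)

text \<open>The new permutation sends \<open>x\<close> to \<open>p y\<close> and \<open>y\<close> to
  \<open>p x\<close> and agrees with \<open>p\<close> elsewhere. A walk from \<open>x\<close>
  therefore runs through the whole cycle of \<open>y\<close>, crosses over at \<open>y\<close>, and
  runs through the whole cycle of \<open>x\<close>.\<close>

lemma orbit_comp_transpose_merge:
  assumes p: "p permutes D" "finite D" and xy: "x \<in> D" "y \<in> D" "orbit p x \<noteq> orbit p y"
  shows "orbit (p \<circ> transpose x y) x = orbit p x \<union> orbit p y"
    and "orbit (p \<circ> transpose x y) y = orbit p x \<union> orbit p y"
proof -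
  define q where "q = p \<circ> transpose x y"
  have q: "q permutes D"
    unfolding q_def using p xy by (intro permutes_compose permutes_swap_id)
  have qx: "q x = p y" and qy: "q y = p x" and qz: "\<And>z. z \<noteq> x \<Longrightarrow> z \<noteq> y \<Longrightarrow> q z = p z"
    by (auto simp: q_def transpose_def)
  have xny: "x \<notin> orbit p y" "y \<notin> orbit p x"
    using permutes_orbit_eq[OF p] xy(3) by metis+
  have py: "orbit p y \<subseteq> orbit q x"
  proof
    fix w assume "w \<in> orbit p y"
    then show "w \<in> orbit q x"
    proof induct
      case base
      then show ?case using orbit.base[of q x] qx by simp
    next
      case (step w)
      show ?case
      proof (cases "w = y")
        case True
        then show ?thesis using orbit.base[of q x] qx by simp
      next
        case False
        with step xny have "q w = p w" using qz by metis
        then show ?thesis using step orbit.step[of w q x] by simp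
      qed
    qed
  qed
  have px: "orbit p x \<subseteq> orbit q y"
  proof
    fix w assume "w \<in> orbit p x"
    then show "w \<in> orbit q y"
    proof induct
      case base
      then show ?case using orbit.base[of q y] qy by simp
    next
      case (step w)
      show ?case
      proof (cases "w = x")
        case True
        then show ?thesis using orbit.base[of q y] qy by simp
      next
        case False
        with step xny have "q w = p w" using qz by metis
        then show ?thesis using step orbit.step[of w q y] by simp
      qed
    qed
  qed
  have "y \<in> orbit q x" using py permutes_self_in_orbit[OF p] by blast
  then have eq: "orbit q y = orbit q x"
    using permutes_orbit_eq[OF q p(2)] by blast
  have "orbit q x \<subseteq> orbit p x \<union> orbit p y"
  proof (rule orbit_subsetI)
    show "q x \<in> orbit p x \<union> orbit p y" using qx orbit.base[of p y] by simp
    fix w assume "w \<in> orbit p x \<union> orbit p y"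
    then show "q w \<in> orbit p x \<union> orbit p y"
      using qx qy qz[of w] by (cases "w = x"; cases "w = y") (auto intro: orbit.intros)
  qed
  with px py eq show "orbit q x = orbit p x \<union> orbit p y" "orbit q y = orbit p x \<union> orbit p y"
    by auto
qed

lemma card_orbits_comp_transpose_merge:
  assumes p: "p permutes D" "finite D" and xy: "x \<in> D" "y \<in> D" "orbit p x \<noteq> orbit p y"
  shows "card (orbit p ` D) = Suc (card (orbit (p \<circ> transpose x y) ` D))"
proof -
  define q where "q = p \<circ> transpose x y"
  define U where "U = orbit p x \<union> orbit p y"
  define R where "R = orbit p ` D - {orbit p x, orbit p y}"
  have q: "q permutes D"
    unfolding q_def using p xy by (intro permutes_compose permutes_swap_id)
  have other: "orbit q z = orbit p z" if "z \<in> D" "orbit p z \<noteq> orbit p x" "orbit p z \<noteq> orbit p y" for z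
    unfolding q_def using that permutes_orbit_eq[OF p]
    by (intro orbit_comp_transpose_other[OF p]) metis+
  have U: "orbit q z = U" if "orbit p z = orbit p x \<or> orbit p z = orbit p y" for z
  proof -
    have "z \<in> orbit q x" "z \<in> orbit q y"
      using that orbit_comp_transpose_merge[OF p xy] permutes_self_in_orbit[OF p, of z]
      unfolding q_def by auto
    then have "orbit q z = orbit q x"
      using permutes_orbit_eq[OF q p(2)] by blast
    then show ?thesis
      using orbit_comp_transpose_merge[OF p xy] unfolding q_def U_def by simp
  qed
  have "orbit q ` D = insert U R"
  proof (intro equalityI subsetI)
    fix A assume "A \<in> orbit q ` D"
    then obtain z where z: "z \<in> D" "A = orbit q z" by blast
    show "A \<in> insert U R"
      using other[OF z(1)] U[of z] z by (cases "orbit p z \<in> {orbit p x, orbit p y}") (auto simp: R_def)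
  next
    fix A assume "A \<in> insert U R"
    then show "A \<in> orbit q ` D"
    proof
      assume "A = U"
      then show ?thesis using U[of x] xy(1) by blast
    next
      assume "A \<in> R"
      then obtain z where "z \<in> D" "A = orbit p z" "orbit p z \<noteq> orbit p x" "orbit p z \<noteq> orbit p y"
        by (auto simp: R_def)
      then show ?thesis using other[of z] by blast
    qed
  qed
  moreover have "U \<notin> R"
  proof
    assume "U \<in> R"
    then obtain z where z: "U = orbit p z" "orbit p z \<noteq> orbit p x" by (auto simp: R_def)
    then have "x \<in> orbit p z" using permutes_self_in_orbit[OF p, of x] by (auto simp: U_def)
    then show False using z(2) permutes_orbit_eq[OF p] by metis
  qed
  moreover have "finite R" using p by (auto simp: R_def)
  ultimately have "card (orbit q ` D) = Suc (card R)" by simp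
  moreover have "card R = card (orbit p ` D) - 2"
    unfolding R_def using xy p by (subst card_Diff_subset) auto
  moreover have "card {orbit p x, orbit p y} \<le> card (orbit p ` D)"
    using xy p by (intro card_mono) auto
  ultimately show ?thesis using xy(3) unfolding q_def by simp
qed

text \<open>From \<open>x\<close> the new permutation jumps to \<open>p y\<close> and follows
  \<open>p\<close> until it is back at \<open>x\<close>, where it closes up. The part of the old
  cycle passed in this way omits \<open>y\<close>.\<close>

lemma orbit_comp_transpose_split:
  assumes p: "p permutes D" "finite D" and xy: "x \<noteq> y" "y \<in> orbit p x"
  shows "y \<notin> orbit (p \<circ> transpose x y) x"
proof -
  define q where "q = p \<circ> transpose x y"
  have x: "x \<in> orbit p y"
    using permutes_orbit_eq[OF p xy(2)] permutes_self_in_orbit[OF p] by simp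
  define d where "d = funpow_dist1 p y x"
  have d: "(p ^^ d) y = x" "0 < d" unfolding d_def using funpow_dist1_prop[OF x] by auto
  \<comment> \<open>The exponents start at 1 and include \<open>d\<close>, the first time at which
    \<open>p\<close> leads from \<open>y\<close> to \<open>x\<close>; so \<open>A\<close> contains
    \<open>x\<close> but not \<open>y\<close>.\<close>
  define A where "A = (\<lambda>k. (p ^^ k) y) ` {0<..d}"
  have ne: "(p ^^ k) y \<noteq> y" if "k \<in> {0<..d}" for k
  proof (cases "k = d")
    case False
    then show ?thesis
      using that funpow_neq_less_funpow_dist1[OF x, of k 0] by (auto simp: d_def)
  qed (use d xy in auto)
  have py: "p y \<in> A" unfolding A_def using d by (intro image_eqI[of _ _ 1]) auto
  have "orbit q x \<subseteq> A"
  proof (rule orbit_subsetI)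
    show "q x \<in> A" using py by (simp add: q_def)
    fix w assume "w \<in> A"
    then obtain k where k: "w = (p ^^ k) y" "k \<in> {0<..d}" by (auto simp: A_def)
    show "q w \<in> A"
    proof (cases "w = x")
      case True
      then show ?thesis using py by (simp add: q_def)
    next
      case False
      with k d have "k < d" by (metis greaterThanAtMost_iff le_neq_implies_less)
      then have "p w \<in> A" unfolding A_def k(1)
        by (intro image_eqI[of _ _ "Suc k"]) auto
      moreover have "q w = p w" using False ne[OF k(2)] k(1) by (simp add: q_def transpose_def)
      ultimately show ?thesis by simp
    qed
  qed
  moreover have "y \<notin> A"
  proof
    assume "y \<in> A"
    then obtain k where k: "y = (p ^^ k) y" "k \<in> {0<..d}" unfolding A_def by (rule imageE)
    then show False using ne[OF k(2)] by simp
  qed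
  ultimately show ?thesis unfolding q_def by blast
qed

text \<open>Composing with the same transposition again gives back \<open>p\<close>, so this is the
  merging count read from the other side.\<close>

lemma card_orbits_comp_transpose_split:
  assumes p: "p permutes D" "finite D" and xy: "x \<in> D" "x \<noteq> y" "y \<in> orbit p x"
  shows "card (orbit (p \<circ> transpose x y) ` D) = Suc (card (orbit p ` D))"
proof -
  define q where "q = p \<circ> transpose x y"
  have y: "y \<in> D" using permutes_orbit_subset[OF p(1) xy(1)] xy(3) by blast
  have q: "q permutes D"
    unfolding q_def using p xy y by (intro permutes_compose permutes_swap_id)
  have "orbit q x \<noteq> orbit q y"
    using orbit_comp_transpose_split[OF p xy(2,3)] permutes_self_in_orbit[OF q p(2), of y]
    unfolding q_def by blast
  then have "card (orbit q ` D) = Suc (card (orbit (q \<circ> transpose x y) ` D))"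
    by (rule card_orbits_comp_transpose_merge[OF q p(2) xy(1) y])
  moreover have "q \<circ> transpose x y = p"
    by (simp add: q_def comp_assoc)
  ultimately show ?thesis by (simp add: q_def)
qed

text \<open>
  Euler's inequality: think of \<open>\<sigma>\<close>, \<open>\<alpha>\<close> and \<open>\<sigma> \<circ> \<alpha>\<close> as the vertices, edges and faces of a map. The
  fibres of \<open>L\<close> are unions of components, and adding an edge within a component creates at
  most one face, while an edge between two components merges two faces.
\<close>

lemma euler_inequality:
  assumes "finite D" "\<sigma> permutes D" "\<alpha> permutes D" "\<And>x. \<alpha> (\<alpha> x) = x"
  shows "\<exists>L :: 'a \<Rightarrow> 'a set. (\<forall>x\<in>D. L (\<sigma> x) = L x) \<and> (\<forall>x\<in>D. L (\<alpha> x) = L x) \<and>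
    2 * card (orbit \<sigma> ` D) + 2 * card (orbit (\<sigma> \<circ> \<alpha>) ` D) \<le> 4 * card (L ` D) + card {x \<in> D. \<alpha> x \<noteq> x}"
  using assms(3,4)
proof (induction "card {x \<in> D. \<alpha> x \<noteq> x}" arbitrary: \<alpha> rule: less_induct)
  case less
  show ?case
  proof (cases "\<exists>x\<in>D. \<alpha> x \<noteq> x")
    case False
    \<comment> \<open>A map without edges: faces and vertices are both the cycles of
      \<open>\<sigma>\<close>, and each is a component, so equality holds.\<close>
    then have "\<alpha> = id" using less.prems(1) by (auto simp: fun_eq_iff permutes_def)
    then show ?thesis
      using permutes_orbit_eq[OF assms(2,1) orbit.base]
      by (intro exI[of _ "orbit \<sigma>"]) auto
  next
    case True
    then obtain x where x: "x \<in> D" "\<alpha> x \<noteq> x" by blast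
    define y where "y = \<alpha> x"
    have y: "y \<in> D" "y \<noteq> x" "\<alpha> y = x"
      using x less.prems by (auto simp: y_def permutes_in_image)
    \<comment> \<open>\<open>\<beta>\<close> deletes the edge formed by \<open>x\<close> and
      \<open>y\<close>: both become fixed points, and the support shrinks by 2.\<close>
    define \<beta> where "\<beta> = \<alpha> \<circ> transpose x y"
    have \<beta>x: "\<beta> x = x" "\<beta> y = y" "\<And>z. z \<noteq> x \<Longrightarrow> z \<noteq> y \<Longrightarrow> \<beta> z = \<alpha> z"
      using y by (auto simp: \<beta>_def y_def[symmetric] transpose_def)
    have \<beta>: "\<beta> permutes D"
      unfolding \<beta>_def using less.prems x y by (intro permutes_compose permutes_swap_id)
    have \<beta>\<beta>: "\<beta> (\<beta> z) = z" for z
    proof (cases "z = x \<or> z = y")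
      case False
      then have "\<alpha> z \<noteq> x" "\<alpha> z \<noteq> y" using less.prems(2) y y_def by metis+
      then show ?thesis using False \<beta>x less.prems(2) by simp
    qed (use \<beta>x in auto)
    have supp: "{z \<in> D. \<alpha> z \<noteq> z} = insert x (insert y {z \<in> D. \<beta> z \<noteq> z})"
    proof (intro set_eqI iffI)
      fix z assume "z \<in> {z \<in> D. \<alpha> z \<noteq> z}"
      then show "z \<in> insert x (insert y {z \<in> D. \<beta> z \<noteq> z})" using \<beta>x(3)[of z] by auto
    next
      fix z assume "z \<in> insert x (insert y {z \<in> D. \<beta> z \<noteq> z})"
      then show "z \<in> {z \<in> D. \<alpha> z \<noteq> z}" using x y \<beta>x(1,2) \<beta>x(3)[of z]
        by (cases "z = x"; cases "z = y") (auto simp: y_def[symmetric])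
    qed
    have cs: "card {z \<in> D. \<alpha> z \<noteq> z} = Suc (Suc (card {z \<in> D. \<beta> z \<noteq> z}))"
      unfolding supp using y \<beta>x assms(1) by (subst card_insert_disjoint; auto)+
    obtain L :: "'a \<Rightarrow> 'a set" where L: "\<forall>z\<in>D. L (\<sigma> z) = L z" "\<forall>z\<in>D. L (\<beta> z) = L z"
      "2 * card (orbit \<sigma> ` D) + 2 * card (orbit (\<sigma> \<circ> \<beta>) ` D) \<le> 4 * card (L ` D) + card {x \<in> D. \<beta> x \<noteq> x}"
      using less.hyps[OF _ \<beta> \<beta>\<beta>] cs by auto
    have \<sigma>\<beta>: "\<sigma> \<circ> \<beta> permutes D" using \<beta> assms(2) by (rule permutes_compose)
    have \<sigma>\<alpha>: "\<sigma> \<circ> \<alpha> = (\<sigma> \<circ> \<beta>) \<circ> transpose x y"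
      by (simp add: \<beta>_def comp_assoc)
    have L\<alpha>: "L (\<alpha> z) = L z" if "z \<in> D" "z \<noteq> x" "z \<noteq> y" for z
      using that L(2) \<beta>x by metis
    show ?thesis
    proof (cases "L x = L y")
      case True
      \<comment> \<open>The edge joins points with the same label: at most one face is gained, worth
        2 on the left, and the support grows by 2 on the right.\<close>
      have "card (orbit (\<sigma> \<circ> \<alpha>) ` D) \<le> Suc (card (orbit (\<sigma> \<circ> \<beta>) ` D))"
      proof (cases "orbit (\<sigma> \<circ> \<beta>) x = orbit (\<sigma> \<circ> \<beta>) y")
        case True
        then have "y \<in> orbit (\<sigma> \<circ> \<beta>) x"
          using permutes_self_in_orbit[OF \<sigma>\<beta> assms(1)] by simp
        then show ?thesis
          unfolding \<sigma>\<alpha> using card_orbits_comp_transpose_split[OF \<sigma>\<beta> assms(1) x(1)] y(2) by simp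
      next
        case False
        then show ?thesis
          unfolding \<sigma>\<alpha> using card_orbits_comp_transpose_merge[OF \<sigma>\<beta> assms(1) x(1) y(1)] by simp
      qed
      moreover have "\<forall>z\<in>D. L (\<alpha> z) = L z"
        using L\<alpha> True y y_def by metis
      ultimately show ?thesis using L cs by (intro exI[of _ L]) auto
    next
      case False
      \<comment> \<open>The edge joins two fibres, which are now united. The right side loses 4 for
        the fibre and gains 2 for the support; the left side loses 2 because two faces
        merge.\<close>
      define M where "M = (\<lambda>z. if L z = L y then L x else L z)"
      \<comment> \<open>A face of the smaller map stays within one fibre of \<open>L\<close>, so
        \<open>x\<close> and \<open>y\<close> lie on different faces.\<close>
      have inv: "orbit (\<sigma> \<circ> \<beta>) x \<subseteq> {z \<in> D. L z = L x}"
        by (rule orbit_subsetI) (use L x \<beta> assms(2) in \<open>auto simp: permutes_in_image\<close>)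
      then have "orbit (\<sigma> \<circ> \<beta>) x \<noteq> orbit (\<sigma> \<circ> \<beta>) y"
        using permutes_self_in_orbit[OF \<sigma>\<beta> assms(1), of y] False by auto
      then have c: "card (orbit (\<sigma> \<circ> \<beta>) ` D) = Suc (card (orbit (\<sigma> \<circ> \<alpha>) ` D))"
        unfolding \<sigma>\<alpha> using card_orbits_comp_transpose_merge[OF \<sigma>\<beta> assms(1) x(1) y(1)] by simp
      have "L ` D = insert (L y) (M ` D)" "L y \<notin> M ` D"
        using x y False by (auto simp: M_def image_iff)
      then have "card (L ` D) = Suc (card (M ` D))" using assms(1) by simp
      moreover have "\<forall>z\<in>D. M (\<sigma> z) = M z" using L by (simp add: M_def)
      moreover have "M (\<alpha> z) = M z" if "z \<in> D" for z
      proof (cases "z = x \<or> z = y")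
        case True
        moreover have "M x = M y" by (simp add: M_def)
        ultimately show ?thesis using y(3) y_def by metis
      qed (use L\<alpha>[OF that] in \<open>simp add: M_def\<close>)
      ultimately show ?thesis using L(3) c cs by (intro exI[of _ M]) auto
    qed
  qed
qed

section \<open>Faces of 2-connected plane graphs\<close>

text \<open>Connectedness is reachability in the symmetrised graph, so a property that agrees at
  both ends of every arc spreads everywhere. All uses of connectivity go through this form.\<close>

lemma connected_invariant:
  assumes "Digraph_Component.connected H" "u \<in> verts H" "w \<in> verts H"
    and "\<And>a. a \<in> arcs H \<Longrightarrow> P (tail H a) \<longleftrightarrow> P (head H a)"
    and "P u"
  shows "P w"
proof -
  have "(u, w) \<in> rtrancl_on (verts H) (parcs (mk_symmetric H))"
    using assms(1-3) unfolding connected_def strongly_connected_def reachable_def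
    by (simp add: mk_symmetric_def)
  then show ?thesis
    by (induct rule: rtrancl_on_induct) (use assms(4,5) in \<open>auto simp: mk_symmetric_def\<close>)
qed

context embedded_graph
begin

text \<open>The face permutation of the combinatorial map whose vertex and edge permutations are
  \<open>asucc\<close> and \<open>arev\<close>.\<close>

definition \<phi> :: "'a \<Rightarrow> 'a" where
  "\<phi> = asucc \<circ> arev"

lemma \<phi>_arev [simp]: "\<phi> (arev a) = asucc a"
  by (simp add: \<phi>_def)

lemma \<phi>_permutes: "\<phi> permutes arcs G"
  unfolding \<phi>_def by (rule permutes_compose[OF arev_permutes_arcs asucc_permutes])

lemma \<phi>_in_arcs [simp]: "\<phi> a \<in> arcs G \<longleftrightarrow> a \<in> arcs G"
  using \<phi>_permutes by (rule permutes_in_image)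

lemma faces_eq: "faces = orbit \<phi> ` arcs G"
  by (simp add: faces_def \<phi>_def)

lemma asucc_in_arcs [simp]: "asucc a \<in> arcs G \<longleftrightarrow> a \<in> arcs G"
  using asucc_permutes by (rule permutes_in_image)

lemma cyclic_on_out_arcs: "a \<in> arcs G \<Longrightarrow> cyclic_on asucc (out_arcs G (tail G a))"
  by (rule asucc_cyclic) auto

lemma orbit_asucc: "a \<in> arcs G \<Longrightarrow> orbit asucc a = out_arcs G (tail G a)"
  by (rule orbit_cyclic_eq3[OF cyclic_on_out_arcs]) auto

lemma tail_asucc [simp]: "a \<in> arcs G \<Longrightarrow> tail G (asucc a) = tail G a"
  using cyclic_on_inI[OF cyclic_on_out_arcs, of a a] by simp

lemma tail_\<phi> [simp]: "a \<in> arcs G \<Longrightarrow> tail G (\<phi> a) = head G a"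
  by (simp add: \<phi>_def)

section \<open>Counting vertices, edges and faces as cycles\<close>

lemma out_arcs_nonempty:
  assumes "card (verts G) > 1" "v \<in> verts G"
  shows "out_arcs G v \<noteq> {}"
proof
  assume empty: "out_arcs G v = {}"
  have "w = v" if "w \<in> verts G" for w
  proof (rule connected_invariant[OF connected assms(2) that])
    fix a assume a: "a \<in> arcs G"
    have "a \<notin> out_arcs G v" "arev a \<notin> out_arcs G v" using empty by auto
    then show "tail G a = v \<longleftrightarrow> head G a = v" using a by simp
  qed simp
  then have "verts G \<subseteq> {v}" by blast
  then have "card (verts G) \<le> 1" using card_mono[of "{v}" "verts G"] by simp
  then show False using assms(1) by simp
qed

text \<open>Vertices correspond to cycles of \<open>asucc\<close> only if each has an arc; the bound
  on the number of vertices excludes the single isolated vertex.\<close>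

lemma card_orbits_asucc:
  assumes "card (verts G) > 1"
  shows "card (orbit asucc ` arcs G) = card (verts G)"
proof -
  have "orbit asucc ` arcs G = out_arcs G ` verts G"
  proof (intro equalityI subsetI)
    fix A assume "A \<in> orbit asucc ` arcs G"
    then show "A \<in> out_arcs G ` verts G" by (auto simp: orbit_asucc)
  next
    fix A assume "A \<in> out_arcs G ` verts G"
    then obtain v where v: "v \<in> verts G" "A = out_arcs G v" by blast
    then obtain a where "a \<in> out_arcs G v"
      using out_arcs_nonempty[OF assms, of v] by blast
    then show "A \<in> orbit asucc ` arcs G" using v orbit_asucc[of a] by auto
  qed
  moreover have "inj_on (out_arcs G) (verts G)"
  proof
    fix v w assume "v \<in> verts G" "w \<in> verts G" "out_arcs G v = out_arcs G w"
    then obtain a where "a \<in> out_arcs G v" "a \<in> out_arcs G w"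
      using out_arcs_nonempty[OF assms] by blast
    then show "v = w" by simp
  qed
  ultimately show ?thesis by (simp add: card_image)
qed

lemma card_arcs: "card (arcs G) = 2 * card edges"
proof -
  have "2 * card edges = card (\<Union>edges)"
  proof (rule card_partition)
    have *: "\<Union>edges = arcs G" by (auto simp: edges_def)
    then show "finite (\<Union>edges)" by simp
    show "finite edges" by (simp add: edges_def)
    show "card e = 2" if "e \<in> edges" for e
      using that arev_neq by (fastforce simp: edges_def)
    show "e \<inter> e' = {}" if "e \<in> edges" "e' \<in> edges" "e \<noteq> e'" for e e'
      using that by (auto simp: edges_def arev_eq_iff)
  qed
  also have "\<Union>edges = arcs G" by (auto simp: edges_def)
  finally show ?thesis ..
qed

lemma euler_formula:
  assumes plane
  shows "card (verts G) + card (orbit \<phi> ` arcs G) = card edges + 2"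
  using assms unfolding plane_def has_genus_def faces_eq by simp

text \<open>
  If a face meets \<open>v\<close> at two corners, splitting \<open>v\<close> along this face raises the numbers of
  vertices and faces by one each, so by Euler's inequality the result is disconnected, and
  then so is \<open>G - v\<close>.
\<close>

lemma inj_on_tail_face:
  assumes plane two_connected "f \<in> faces"
    and loopfree: "\<And>a. a \<in> arcs G \<Longrightarrow> tail G a \<noteq> head G a"
  shows "inj_on (tail G) f"
proof (rule inj_onI, rule ccontr)
  fix a b assume ab: "a \<in> f" "b \<in> f" "tail G a = tail G b" "a \<noteq> b"
  define v where "v = tail G a"
  note \<phi> = \<phi>_permutes finite_arcs and as = asucc_permutes finite_arcs
  obtain c where c: "c \<in> arcs G" "f = orbit \<phi> c" using assms(3) by (auto simp: faces_eq)
  have arcs: "a \<in> arcs G" "b \<in> arcs G"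
    using ab c permutes_orbit_subset[OF \<phi>(1) c(1)] by blast+
  have orb: "orbit \<phi> a = orbit \<phi> b" using ab c permutes_orbit_eq[OF \<phi>] by simp
  have surj: "surj asucc" using permutes_surj[OF asucc_permutes] .
  \<comment> \<open>The corners of the face at \<open>v\<close> lie just before \<open>a\<close> and
    just before \<open>b\<close> in the cyclic order, so the cut is made at the predecessors of
    \<open>a\<close> and \<open>b\<close>.\<close>
  obtain x where x: "asucc x = a" using surj by (metis surjD)
  obtain y where y: "asucc y = b" using surj by (metis surjD)
  have xy: "x \<in> arcs G" "y \<in> arcs G" "x \<noteq> y"
    using arcs ab x y asucc_in_arcs by metis+
  have tx: "tail G x = v" "tail G y = v" using xy x y ab tail_asucc by (auto simp: v_def)
  \<comment> \<open>\<open>s\<close> breaks the rotation at \<open>v\<close> into two cycles, that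
    is, it splits \<open>v\<close> into two vertices.\<close>
  define s where "s = asucc \<circ> transpose x y"
  have s: "s permutes arcs G"
    unfolding s_def using xy asucc_permutes by (intro permutes_compose permutes_swap_id)
  have "y \<in> orbit asucc x" using xy tx by (simp add: orbit_asucc)
  then have V: "card (orbit s ` arcs G) = Suc (card (verts G))"
    unfolding s_def card_orbits_comp_transpose_split[OF as xy(1,3) \<open>y \<in> orbit asucc x\<close>]
    using assms(2) by (subst card_orbits_asucc) (auto simp: two_connected_def)
  \<comment> \<open>Splitting the vertex also composes the face permutation with a transposition.
    Its two arcs precede \<open>a\<close> and \<open>b\<close> on their common face, so this face is
    split as well.\<close>
  have "s \<circ> arev = \<phi> \<circ> transpose (arev x) (arev y)"
    by (auto simp: s_def \<phi>_def fun_eq_iff transpose_def arev_eq_iff)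
  moreover have "\<phi> (arev x) = a" "\<phi> (arev y) = b" using x y by simp_all
  then have "orbit \<phi> (arev x) = orbit \<phi> (arev y)"
    using orb permutes_orbit_eq[OF \<phi> orbit.base] by metis
  then have "arev y \<in> orbit \<phi> (arev x)" using permutes_self_in_orbit[OF \<phi>] by simp
  moreover have "arev x \<noteq> arev y" using xy by (simp add: arev_eq_iff)
  ultimately have F: "card (orbit (s \<circ> arev) ` arcs G) = Suc (card (orbit \<phi> ` arcs G))"
    using card_orbits_comp_transpose_split[OF \<phi>] xy by simp
  have "{a \<in> arcs G. arev a \<noteq> a} = arcs G" using arev_neq by blast
  moreover obtain L :: "'a \<Rightarrow> 'a set" where "(\<forall>z\<in>arcs G. L (s z) = L z) \<and> (\<forall>z\<in>arcs G. L (arev z) = L z) \<and>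
      2 * card (orbit s ` arcs G) + 2 * card (orbit (s \<circ> arev) ` arcs G)
        \<le> 4 * card (L ` arcs G) + card {a \<in> arcs G. arev a \<noteq> a}"
    using euler_inequality[OF finite_arcs s arev_permutes_arcs arev_arev] by (rule exE)
  ultimately have L: "\<And>z. z \<in> arcs G \<Longrightarrow> L (s z) = L z"
      "\<And>z. z \<in> arcs G \<Longrightarrow> L (arev z) = L z"
      "2 * card (orbit s ` arcs G) + 2 * card (orbit (s \<circ> arev) ` arcs G) \<le> 4 * card (L ` arcs G) + card (arcs G)"
    by simp_all
  \<comment> \<open>With one more vertex and one more face the left side is 2(V + F) + 4 = 2E + 8,
    while \<open>card (arcs G)\<close> is 2E; so there are at least two labels.\<close>
  then have ge2: "card (L ` arcs G) \<ge> 2"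
    using V F card_arcs euler_formula[OF assms(1)] by linarith

  \<comment> \<open>Away from \<open>v\<close> the rotation is unchanged, so \<open>L\<close>
    depends only on the tail there and can be propagated through the connected graph G - v.\<close>
  have around: "L d = L e" if "d \<in> arcs G" "tail G d = tail G e" "tail G e \<noteq> v" "e \<in> arcs G" for d e
  proof -
    have "orbit asucc e \<subseteq> {z \<in> arcs G. tail G z \<noteq> v \<and> L z = L e}"
    proof (rule orbit_subsetI)
      have step: "L (asucc z) = L z" if "z \<in> arcs G" "tail G z \<noteq> v" for z
        using L(1)[OF that(1)] that tx by (auto simp: s_def transpose_def split: if_splits)
      show "asucc e \<in> {z \<in> arcs G. tail G z \<noteq> v \<and> L z = L e}"
        using that step[of e] by simp
      show "asucc z \<in> {z \<in> arcs G. tail G z \<noteq> v \<and> L z = L e}"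
        if "z \<in> {z \<in> arcs G. tail G z \<noteq> v \<and> L z = L e}" for z
        using that step[of z] by simp
    qed
    moreover have "d \<in> orbit asucc e" using that by (simp add: orbit_asucc)
    ultimately show ?thesis by blast
  qed
  let ?H = "pre_digraph.del_vert G v"
  have H: "Digraph_Component.connected ?H"
    using assms(2) arcs by (auto simp: two_connected_def v_def)
  have nv: "head G a \<noteq> v" using loopfree[OF arcs(1)] by (simp add: v_def)
  have same: "L d = L a" if "d \<in> arcs G" "tail G d \<noteq> v" for d
  proof -
    define P where "P w \<longleftrightarrow> (\<exists>e\<in>arcs G. tail G e = w \<and> L e = L a)" for w
    have "P (tail G d)"
    proof (rule connected_invariant[OF H])
      show "head G a \<in> verts ?H" "tail G d \<in> verts ?H"
        using arcs nv that by (auto simp: del_vert_simps)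
      show "P (head G a)" unfolding P_def using arcs L(2) by (intro bexI[of _ "arev a"]) auto
      have half: "P (head G e)" if e: "e \<in> arcs G" "tail G e \<noteq> v" "head G e \<noteq> v" "P (tail G e)" for e
      proof -
        from e obtain e' where "e' \<in> arcs G" "tail G e' = tail G e" "L e' = L a"
          by (auto simp: P_def)
        then have "L e = L a" using around[of e e'] e by simp
        then show ?thesis unfolding P_def using e L(2) by (intro bexI[of _ "arev e"]) auto
      qed
      fix e assume "e \<in> arcs ?H"
      then have e: "e \<in> arcs G" "tail G e \<noteq> v" "head G e \<noteq> v" by (auto simp: del_vert_simps)
      then show "P (tail ?H e) \<longleftrightarrow> P (head ?H e)"
        using half[of e] half[of "arev e"] by (auto simp: del_vert_simps)
    qed
    then obtain e where "e \<in> arcs G" "tail G e = tail G d" "L e = L a" by (auto simp: P_def)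
    then show ?thesis using around[of d e] that by simp
  qed
  have "L d = L a" if "d \<in> arcs G" for d
  proof (cases "tail G d = v")
    case True
    then have "L (arev d) = L a" using same[of "arev d"] loopfree[OF that] that by simp
    then show ?thesis using L(2)[OF that] by simp
  qed (use same that in auto)
  then have "L ` arcs G \<subseteq> {L a}" by blast
  then have "card (L ` arcs G) \<le> 1" using card_mono[of "{L a}"] by fastforce
  then show False using ge2 by simp
qed

text \<open>If \<open>v\<close> had a single arc, deleting its other end would isolate
  \<open>v\<close>; as the rest stays connected, the graph would have only two vertices.\<close>

lemma two_le_card_out_arcs:
  assumes two_connected "v \<in> verts G"
    and loopfree: "\<And>a. a \<in> arcs G \<Longrightarrow> tail G a \<noteq> head G a"
  shows "2 \<le> card (out_arcs G v)"
proof (rule ccontr)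
  assume "\<not> 2 \<le> card (out_arcs G v)"
  moreover have three: "card (verts G) > 2" using assms(1) by (simp add: two_connected_def)
  then have ne: "out_arcs G v \<noteq> {}" using out_arcs_nonempty assms(2) by simp
  then have "card (out_arcs G v) \<noteq> 0" by (simp add: finite_out_arcs)
  ultimately have "card (out_arcs G v) = 1" by linarith
  then obtain a where a: "out_arcs G v = {a}" by (rule card_1_singletonE)
  then have a': "a \<in> arcs G" "tail G a = v" by (auto simp: out_arcs_def)
  let ?u = "head G a"
  let ?H = "pre_digraph.del_vert G ?u"
  have uv: "v \<noteq> ?u" using loopfree[OF a'(1)] a' by simp
  have H: "Digraph_Component.connected ?H"
    using assms(1) a' by (auto simp: two_connected_def)
  have "w = v" if "w \<in> verts ?H" for w
  proof (rule connected_invariant[OF H _ that])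
    show "v \<in> verts ?H" using assms(2) uv by (simp add: del_vert_simps)
    fix e assume "e \<in> arcs ?H"
    then have e: "e \<in> arcs G" "tail G e \<noteq> ?u" "head G e \<noteq> ?u" by (auto simp: del_vert_simps)
    have "e \<notin> out_arcs G v" using e a by auto
    moreover have "arev e \<notin> out_arcs G v" using e a by auto
    ultimately show "tail ?H e = v \<longleftrightarrow> head ?H e = v"
      using e by (auto simp: del_vert_simps)
  qed simp
  then have "verts G \<subseteq> {v, ?u}" by (auto simp: del_vert_simps)
  then have "card (verts G) \<le> card {v, ?u}" by (intro card_mono) auto
  then show False using three uv by simp
qed

end

section \<open>Orbits of two involutions\<close>

lemma sigma_orbit_self: "C \<in> sigma_orbit \<sigma> I C"
  unfolding sigma_orbit_def by (rule image_eqI[of _ _ "[]"]) auto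

lemma sigma_orbit_step:
  assumes "x \<in> sigma_orbit \<sigma> I C" "i \<in> I"
  shows "\<sigma> i x \<in> sigma_orbit \<sigma> I C"
proof -
  obtain w where "w \<in> lists I" "x = foldl (\<lambda>x i. \<sigma> i x) C w"
    using assms(1) by (auto simp: sigma_orbit_def)
  then show ?thesis
    unfolding sigma_orbit_def using assms(2) by (intro image_eqI[of _ _ "w @ [i]"]) auto
qed

lemma sigma_orbit_subsetI:
  assumes "C \<in> A" "\<And>i x. i \<in> I \<Longrightarrow> x \<in> A \<Longrightarrow> \<sigma> i x \<in> A"
  shows "sigma_orbit \<sigma> I C \<subseteq> A"
proof
  fix x assume "x \<in> sigma_orbit \<sigma> I C"
  then obtain w where w: "w \<in> lists I" "x = foldl (\<lambda>x i. \<sigma> i x) C w"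
    by (auto simp: sigma_orbit_def)
  from w(1) have "foldl (\<lambda>x i. \<sigma> i x) C w \<in> A"
    by (induction w rule: rev_induct) (use assms in auto)
  then show "x \<in> A" using w by simp
qed

lemma orbit_period:
  assumes "x \<in> orbit p x"
  shows "(p ^^ card (orbit p x)) x = x" and "card (orbit p x) > 0"
proof -
  have "card (orbit p x) = card {0..<funpow_dist1 p x x}"
    unfolding orbit_conv_funpow_dist1[OF assms]
    by (rule card_image[OF inj_on_funpow_dist1[OF assms]])
  then have "card (orbit p x) = funpow_dist1 p x x" by simp
  then show "(p ^^ card (orbit p x)) x = x" "card (orbit p x) > 0"
    using funpow_dist1_prop[OF assms] by auto
qed

text \<open>
  The orbit \<open>X\<close> is the union of the rotation orbits of \<open>C\<close> and of \<open>\<sigma> i C\<close>. These have equal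
  size and are equal or disjoint; a labelling \<open>\<chi>\<close> flipped by both involutions separates them.
\<close>

lemma dihedral_orbit:
  fixes \<sigma> :: "nat \<Rightarrow> 'c \<Rightarrow> 'c"
  assumes X: "X = sigma_orbit \<sigma> {i, j} C" and fin: "finite X"
    and inv: "\<And>x. x \<in> X \<Longrightarrow> \<sigma> i (\<sigma> i x) = x" "\<And>x. x \<in> X \<Longrightarrow> \<sigma> j (\<sigma> j x) = x"
  shows "((\<lambda>x. \<sigma> j (\<sigma> i x)) ^^ card X) C = C"
    and "\<lbrakk>\<And>x. x \<in> X \<Longrightarrow> \<chi> (\<sigma> i x) \<longleftrightarrow> \<not> \<chi> x; \<And>x. x \<in> X \<Longrightarrow> \<chi> (\<sigma> j x) \<longleftrightarrow> \<not> \<chi> x\<rbrakk>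
      \<Longrightarrow> even (card X) \<and> ((\<lambda>x. \<sigma> j (\<sigma> i x)) ^^ (card X div 2)) C = C"
proof -
  define r where "r = \<sigma> i"
  define s where "s = \<sigma> j"
  define \<rho> where "\<rho> = (\<lambda>x. s (r x))"
  have C: "C \<in> X" unfolding X by (rule sigma_orbit_self)
  have rX: "r x \<in> X" and sX: "s x \<in> X" if "x \<in> X" for x
    using that unfolding X r_def s_def by (auto intro: sigma_orbit_step)
  have rr: "r (r x) = x" and ss: "s (s x) = x" if "x \<in> X" for x
    using inv that by (auto simp: r_def s_def)
  \<comment> \<open>The maps are involutions only on \<open>X\<close>, so the rotation is made the
    identity outside \<open>X\<close> to obtain a permutation.\<close>
  define p where "p = perm_restrict \<rho> X"
  have pX: "p x = s (r x)" if "x \<in> X" for x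
    using that by (simp add: p_def perm_restrict_def \<rho>_def)
  have p: "p permutes X"
  proof (rule bij_imp_permutes)
    show "bij_betw p X X"
      by (rule bij_betw_byWitness[where f' = "\<lambda>x. r (s x)"]) (use rX sX rr ss pX in auto)
    show "p x = x" if "x \<notin> X" for x using that by (simp add: p_def perm_restrict_def)
  qed
  define Q where "Q = orbit p C"
  have QX: "Q \<subseteq> X" unfolding Q_def using permutes_orbit_subset[OF p C] .
  have self: "x \<in> orbit p x" for x using permutes_self_in_orbit[OF p fin] .
  have pQ: "p x \<in> Q" if "x \<in> Q" for x using that unfolding Q_def by (rule orbit.step)
  have Q_surj: "\<exists>y\<in>Q. x = p y" if "x \<in> Q" for x
  proof -
    have "x \<in> orbit p x" by (rule self)
    then show ?thesis
    proof cases
      case base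
      with that show ?thesis by auto
    next
      case (step y)
      have "orbit p x = Q" using that unfolding Q_def by (rule permutes_orbit_eq[OF p fin])
      with step show ?thesis by auto
    qed
  qed
  have pow: "(\<rho> ^^ k) C = (p ^^ k) C" for k
  proof (induction k)
    case (Suc k)
    have "(p ^^ k) C \<in> Q" unfolding Q_def using self by (rule funpow_in_orbit)
    then have "(p ^^ k) C \<in> X" using QX by blast
    then show ?case using Suc by (simp add: pX \<rho>_def)
  qed simp
  define d where "d = card Q"
  have d: "(p ^^ d) C = C" "d > 0" unfolding d_def Q_def using orbit_period[OF self] by auto
  \<comment> \<open>Writing \<open>x\<close> as \<open>s (r y)\<close> gives
    \<open>s x = r y\<close>: both reflections send the rotation orbit \<open>Q\<close> to the same
    mirror image.\<close>
  have s_rQ: "\<exists>w\<in>Q. s x = r w" if x: "x \<in> Q" for x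
  proof -
    obtain y where y: "y \<in> Q" "x = p y" using Q_surj[OF x] by blast
    then have "s x = r y" using QX rX pX ss by auto
    then show ?thesis using y by blast
  qed
  have "X \<subseteq> Q \<union> r ` Q"
    unfolding X
  proof (rule sigma_orbit_subsetI)
    show "C \<in> Q \<union> r ` Q" unfolding Q_def using self by blast
    fix l x assume l: "l \<in> {i, j}" and x: "x \<in> Q \<union> r ` Q"
    have "r x \<in> Q \<union> r ` Q" using x rr QX by auto
    moreover have "s x \<in> Q \<union> r ` Q"
      using x
    proof
      assume "x \<in> r ` Q"
      then obtain y where "y \<in> Q" "x = r y" by blast
      then have "s x = p y" using pX QX by auto
      then show ?thesis using pQ \<open>y \<in> Q\<close> by auto
    qed (use s_rQ in blast)
    ultimately show "\<sigma> l x \<in> Q \<union> r ` Q" using l by (auto simp: r_def s_def)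
  qed
  then have XQ: "X = Q \<union> r ` Q" using QX rX by auto
  have finQ: "finite Q" using QX fin finite_subset by blast
  have "inj_on r Q" using rr QX by (intro inj_on_inverseI[of _ r]) auto
  then have cr: "card (r ` Q) = d" unfolding d_def by (rule card_image)
  have cX: "card X = 2 * d" if "Q \<inter> r ` Q = {}"
    unfolding XQ using that finQ cr by (subst card_Un_disjoint) (auto simp: d_def)
  \<comment> \<open>\<open>Q\<close> and its mirror image coincide or are disjoint; in either case
    the period \<open>d\<close> divides the size of \<open>X\<close>.\<close>
  have "card X = d \<or> card X = 2 * d"
  proof (cases "Q \<inter> r ` Q = {}")
    case False
    then obtain z where z: "z \<in> Q" "z \<in> r ` Q" by blast
    have closed: "p x \<in> r ` Q" if x: "x \<in> r ` Q" for x
    proof -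
      obtain y where y: "y \<in> Q" "x = r y" using x by blast
      then have "p x = s y" using rX rr pX QX by auto
      then show ?thesis using s_rQ y by auto
    qed
    have "orbit p z \<subseteq> r ` Q" using closed[OF z(2)] closed by (rule orbit_subsetI)
    moreover have "orbit p z = Q" using z(1) unfolding Q_def by (rule permutes_orbit_eq[OF p fin])
    ultimately have "r ` Q = Q" using cr finQ card_subset_eq[of "r ` Q" Q] by (auto simp: d_def)
    then show ?thesis using XQ by (simp add: d_def)
  qed (use cX in simp)
  moreover have "(p ^^ (2 * d)) C = C" using d by (simp add: mult_2 funpow_add)
  ultimately have "(\<rho> ^^ card X) C = C" using d pow by auto
  then show "((\<lambda>x. \<sigma> j (\<sigma> i x)) ^^ card X) C = C" unfolding \<rho>_def r_def s_def .

  assume \<chi>: "\<And>x. x \<in> X \<Longrightarrow> \<chi> (\<sigma> i x) \<longleftrightarrow> \<not> \<chi> x" "\<And>x. x \<in> X \<Longrightarrow> \<chi> (\<sigma> j x) \<longleftrightarrow> \<not> \<chi> x"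
  have \<chi>p: "\<chi> (p x) = \<chi> x" if "x \<in> X" for x
    using that rX[OF that] pX \<chi> by (simp add: r_def s_def)
  \<comment> \<open>A rotation flips the label twice, so \<open>Q\<close> carries one label and its
    mirror image the other.\<close>
  have "Q \<subseteq> {x \<in> X. \<chi> x = \<chi> C}"
    unfolding Q_def by (rule orbit_subsetI) (use C \<chi>p permutes_in_image[OF p] in auto)
  then have "\<chi> x = \<chi> C" "\<chi> (r x) \<noteq> \<chi> C" if "x \<in> Q" for x
    using that \<chi>(1)[of x] by (auto simp: r_def)
  then have "Q \<inter> r ` Q = {}" by blast
  then have "card X = 2 * d" by (rule cX)
  then show "even (card X) \<and> ((\<lambda>x. \<sigma> j (\<sigma> i x)) ^^ (card X div 2)) C = C"
    using d(1) pow[of d] unfolding \<rho>_def r_def s_def by simp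
qed

text \<open>At most one element of the cycle lies in \<open>Z\<close>, and removing it leaves a path
  along which \<open>P\<close> spreads. The intended cycle consists of the arcs leaving a vertex,
  with \<open>Z\<close> the outer face.\<close>

lemma cyclic_on_invariant:
  assumes cyc: "cyclic_on f S" and Z: "\<And>y z. y \<in> S \<inter> Z \<Longrightarrow> z \<in> S \<inter> Z \<Longrightarrow> y = z"
    and P: "\<And>b. b \<in> S \<Longrightarrow> b \<notin> Z \<Longrightarrow> f b \<notin> Z \<Longrightarrow> P b \<longleftrightarrow> P (f b)"
    and a: "a \<in> S - Z" "P a" and b: "b \<in> S - Z"
  shows "P b"
proof (cases "S \<inter> Z = {}")
  case True
  have "orbit f a \<subseteq> {x \<in> S. P x}"
    by (rule orbit_subsetI) (use a P cyclic_on_inI[OF cyc] True in auto)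
  moreover have "orbit f a = S" using a by (intro orbit_cyclic_eq3[OF cyc]) simp
  ultimately show ?thesis using b by auto
next
  case False
  then obtain z where z: "z \<in> S" "z \<in> Z" by blast
  then have zz: "y = z" if "y \<in> S" "y \<in> Z" for y using Z that by blast
  \<comment> \<open>The path begins at \<open>f z\<close>, just after the removed element, so every
    \<open>P x\<close> is compared with \<open>P (f z)\<close>.\<close>
  have "orbit f z \<subseteq> {x \<in> S. x \<in> Z \<or> P x = P (f z)}"
  proof (rule orbit_subsetI)
    show "f z \<in> {x \<in> S. x \<in> Z \<or> P x = P (f z)}" using cyclic_on_inI[OF cyc z(1)] by simp
    fix y assume y: "y \<in> {x \<in> S. x \<in> Z \<or> P x = P (f z)}"
    then have "f y \<in> S" using cyclic_on_inI[OF cyc] by simp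
    then show "f y \<in> {x \<in> S. x \<in> Z \<or> P x = P (f z)}"
      using y zz[of y] P[of y] by (cases "y \<in> Z") auto
  qed
  moreover have "orbit f z = S" using cyc z(1) by (rule orbit_cyclic_eq3)
  ultimately have "P x = P (f z)" if "x \<in> S - Z" for x using that by auto
  then show ?thesis using a b by blast
qed

section \<open>Chambers\<close>

context lsp_operation
begin

lemma loopfree: "a \<in> arcs G \<Longrightarrow> tail G a \<noteq> head G a"
  using type_proper by metis

lemma inj_on_tail_outer: "inj_on (tail G) outer"
  using plane two_connected outer_face loopfree by (rule inj_on_tail_face)

lemma self_in_face: "a \<in> orbit \<phi> a"
  using \<phi>_permutes finite_arcs by (rule permutes_self_in_orbit)

lemma face_eq: "f \<in> faces \<Longrightarrow> a \<in> f \<Longrightarrow> f = orbit \<phi> a"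
  unfolding faces_eq using permutes_orbit_eq[OF \<phi>_permutes finite_arcs] by blast

lemma face_subset_arcs: "f \<in> faces \<Longrightarrow> f \<subseteq> arcs G"
  unfolding faces_eq using permutes_orbit_subset[OF \<phi>_permutes] by blast

lemma outer_subset_arcs: "outer \<subseteq> arcs G"
  using outer_face by (rule face_subset_arcs)

lemma in_outer_iff: "a \<in> outer \<longleftrightarrow> orbit \<phi> a = outer"
  using face_eq[OF outer_face] self_in_face by blast

lemma orbit_\<phi> [simp]: "orbit \<phi> (\<phi> a) = orbit \<phi> a"
  using permutes_orbit_eq[OF \<phi>_permutes finite_arcs orbit.base] .

lemma \<phi>_in_outer_iff [simp]: "\<phi> a \<in> outer \<longleftrightarrow> a \<in> outer"
  unfolding in_outer_iff orbit_\<phi> ..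

lemma chambers_eq: "chambers = orbit \<phi> ` (arcs G - outer)"
  unfolding chambers_def faces_eq using in_outer_iff by auto

lemma finite_chambers: "finite chambers"
  unfolding chambers_eq by simp

text \<open>A cycle of length 3 closes after three steps, and any two corners of a triangle are
  joined by an edge, so \<open>type_proper\<close> separates all three types.\<close>

lemma chamber:
  assumes "a \<in> arcs G - outer"
  shows "\<phi> (\<phi> (\<phi> a)) = a" and "orbit \<phi> a = {a, \<phi> a, \<phi> (\<phi> a)}"
    and "t (tail G a) \<noteq> t (head G a)" and "t (tail G a) \<noteq> t (tail G (\<phi> (\<phi> a)))"
    and "t (head G a) \<noteq> t (tail G (\<phi> (\<phi> a)))"
proof -
  have "orbit \<phi> a \<in> faces" "orbit \<phi> a \<noteq> outer"
    using assms in_outer_iff by (auto simp: faces_eq)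
  then have "card (orbit \<phi> a) = 3" by (rule inner_triangle)
  then have 3: "(\<phi> ^^ 3) a = a" using orbit_period(1)[OF self_in_face, of a] by simp
  then show *: "\<phi> (\<phi> (\<phi> a)) = a" by (simp add: numeral_3_eq_3)
  have "orbit \<phi> a = {(\<phi> ^^ k) a | k. k < 3}" by (rule orbit_altdef_bounded[OF 3]) simp
  also have "\<dots> = (\<lambda>k. (\<phi> ^^ k) a) ` {..<3}" by auto
  also have "\<dots> = {a, \<phi> a, \<phi> (\<phi> a)}" by (auto simp: numeral_3_eq_3 lessThan_Suc)
  finally show "orbit \<phi> a = {a, \<phi> a, \<phi> (\<phi> a)}" .
  have a: "a \<in> arcs G" "\<phi> a \<in> arcs G" "\<phi> (\<phi> a) \<in> arcs G" using assms \<phi>_in_arcs by auto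
  show "t (tail G a) \<noteq> t (head G a)" using type_proper[OF a(1)] .
  show "t (tail G a) \<noteq> t (tail G (\<phi> (\<phi> a)))"
    using type_proper[OF a(3)] tail_\<phi>[OF a(3)] * by simp
  show "t (head G a) \<noteq> t (tail G (\<phi> (\<phi> a)))"
    using type_proper[OF a(2)] tail_\<phi>[OF a(1)] tail_\<phi>[OF a(2)] by simp
qed

lemma type_le: "a \<in> arcs G \<Longrightarrow> t (tail G a) \<le> 2" "a \<in> arcs G \<Longrightarrow> t (head G a) \<le> 2"
  using type_range[of "tail G a"] type_range[of "head G a"] by auto

lemma chamber_arc_unique:
  assumes "a \<in> arcs G - outer" "b \<in> arcs G - outer" "orbit \<phi> a = orbit \<phi> b"
    "t (tail G a) = t (tail G b)"
  shows "a = b"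
proof -
  have "b \<in> {a, \<phi> a, \<phi> (\<phi> a)}"
    using assms(3) self_in_face[of b] chamber(2)[OF assms(1)] by simp
  then show ?thesis
    using chamber(3,4)[OF assms(1)] assms(1,4) tail_\<phi>[of a] by auto
qed

lemma chamber_arc_exists:
  assumes "C \<in> chambers" "k \<le> 2"
  obtains a where "a \<in> arcs G - outer" "C = orbit \<phi> a" "t (tail G a) = k"
proof -
  obtain a where a: "a \<in> arcs G - outer" "C = orbit \<phi> a" using assms(1) unfolding chambers_eq by blast
  then have a': "a \<in> arcs G" "\<phi> a \<in> arcs G" "\<phi> (\<phi> a) \<in> arcs G" using \<phi>_in_arcs by auto
  have b: "\<phi> a \<in> arcs G - outer" "\<phi> (\<phi> a) \<in> arcs G - outer" "C = orbit \<phi> (\<phi> a)" "C = orbit \<phi> (\<phi> (\<phi> a))"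
    using a by simp_all
  have "t (tail G a) = k \<or> t (tail G (\<phi> a)) = k \<or> t (tail G (\<phi> (\<phi> a))) = k"
    using chamber(3-5)[OF a(1)] type_le(1)[OF a'(1)] type_le(1)[OF a'(2)] type_le(1)[OF a'(3)] assms(2)
    unfolding tail_\<phi>[OF a'(1)] by linarith
  then show thesis using that[OF a] that[OF b(1,3)] that[OF b(2,4)] by blast
qed

text \<open>A chamber is named by its arc leaving the corner of a chosen type. This turns sums over
  chambers into sums over arcs, which can be grouped by vertex.\<close>

lemma bij_betw_chambers:
  assumes "k \<le> 2"
  shows "bij_betw (orbit \<phi>) {a \<in> arcs G - outer. t (tail G a) = k} chambers"
  unfolding bij_betw_def
proof
  show "inj_on (orbit \<phi>) {a \<in> arcs G - outer. t (tail G a) = k}"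
    by (rule inj_onI) (use chamber_arc_unique in auto)
  show "orbit \<phi> ` {a \<in> arcs G - outer. t (tail G a) = k} = chambers"
  proof (intro equalityI subsetI)
    fix C assume "C \<in> chambers"
    then show "C \<in> orbit \<phi> ` {a \<in> arcs G - outer. t (tail G a) = k}"
      by (rule chamber_arc_exists[OF _ assms]) simp
  qed (auto simp: chambers_eq)
qed

text \<open>The third corner has type \<open>i\<close>, so \<open>a\<close> is the only arc of the
  chamber lying on an \<open>i\<close>-edge, and the neighbour across it is the face of
  \<open>arev a\<close>. This makes the definite description in \<open>sigma\<close>
  explicit.\<close>

lemma sigma_eq:
  assumes a: "a \<in> arcs G - outer" and i: "i \<le> 2" "t (tail G a) \<noteq> i" "t (head G a) \<noteq> i"
  shows "sigma i (orbit \<phi> a) = (if arev a \<in> outer then orbit \<phi> a else orbit \<phi> (arev a))"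
proof -
  have a': "a \<in> arcs G" "\<phi> a \<in> arcs G" "\<phi> (\<phi> a) \<in> arcs G" "arev a \<in> arcs G"
    using a \<phi>_in_arcs by auto
  have third: "t (tail G (\<phi> (\<phi> a))) = i"
    using chamber(3-5)[OF a] type_le[OF a'(1)] type_le(1)[OF a'(3)] i by linarith
  have "edge_of_type i a" "\<not> edge_of_type i (\<phi> a)" "\<not> edge_of_type i (\<phi> (\<phi> a))"
    using i third tail_\<phi>[OF a'(2)] by (simp_all add: edge_of_type_def)
  then have "edge_of_type i b \<longleftrightarrow> b = a" if "b \<in> orbit \<phi> a" for b
    using that unfolding chamber(2)[OF a] by blast
  then have shares: "shares_edge i (orbit \<phi> a) f \<longleftrightarrow> arev a \<in> f" for f
    unfolding shares_edge_def using self_in_face[of a] by auto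
  \<comment> \<open>The neighbour has to be a different chamber: if the triangle contained both
    directions of an edge, two of its corners would have the same type.\<close>
  have notin: "arev a \<notin> orbit \<phi> a"
  proof
    assume "arev a \<in> orbit \<phi> a"
    then have "arev a = \<phi> a \<or> arev a = \<phi> (\<phi> a)"
      using chamber(2)[OF a] arev_neq[OF a'(1)] by auto
    then show False
    proof
      assume *: "arev a = \<phi> a"
      have "head G (arev a) = tail G (\<phi> (\<phi> a))" using tail_\<phi>[OF a'(2)] unfolding * by simp
      then show False using chamber(4)[OF a] a'(1) by simp
    next
      assume "arev a = \<phi> (\<phi> a)"
      then show False using chamber(5)[OF a] tail_arev[OF a'(1)] by simp
    qed
  qed
  show ?thesis
  proof (cases "arev a \<in> outer")
    case True
    then show ?thesis by (simp add: sigma_def shares)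
  next
    case False
    have "(THE C'. C' \<in> chambers \<and> C' \<noteq> orbit \<phi> a \<and> arev a \<in> C') = orbit \<phi> (arev a)"
    proof (rule the_equality)
      show "orbit \<phi> (arev a) \<in> chambers \<and> orbit \<phi> (arev a) \<noteq> orbit \<phi> a \<and> arev a \<in> orbit \<phi> (arev a)"
        using False a'(4) notin self_in_face[of "arev a"] unfolding chambers_eq by auto
      show "C' = orbit \<phi> (arev a)" if "C' \<in> chambers \<and> C' \<noteq> orbit \<phi> a \<and> arev a \<in> C'" for C'
        using that face_eq by (auto simp: chambers_def)
    qed
    then show ?thesis using False by (simp add: sigma_def shares)
  qed
qed

lemma corner_eq:
  assumes a: "a \<in> arcs G - outer" and "i \<le> 2" "j \<le> 2" "i \<noteq> j" "t (tail G a) \<noteq> i" "t (tail G a) \<noteq> j"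
  shows "corner i j (orbit \<phi> a) = tail G a"
  unfolding corner_def
proof (rule the_equality)
  show "tail G a \<in> face_verts (orbit \<phi> a) \<and> t (tail G a) \<noteq> i \<and> t (tail G a) \<noteq> j"
    using assms self_in_face[of a] by (auto simp: face_verts_def)
  fix v assume v: "v \<in> face_verts (orbit \<phi> a) \<and> t v \<noteq> i \<and> t v \<noteq> j"
  have a': "a \<in> arcs G" "\<phi> (\<phi> a) \<in> arcs G" using a \<phi>_in_arcs by auto
  have "v = tail G a \<or> v = head G a \<or> v = tail G (\<phi> (\<phi> a))"
    using v chamber(2)[OF a] tail_\<phi>[OF a'(1)] by (auto simp: face_verts_def)
  then show "v = tail G a"
  proof (elim disjE)
    assume "v = head G a"
    then have "t v = t (head G a)" by simp
    then show ?thesis using v assms(2-6) chamber(3)[OF a] type_le[OF a'(1)] by linarith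
  next
    assume "v = tail G (\<phi> (\<phi> a))"
    then have "t v = t (tail G (\<phi> (\<phi> a)))" by simp
    then show ?thesis
      using v assms(2-6) chamber(4)[OF a] type_le(1)[OF a'(1)] type_le(1)[OF a'(2)] by linarith
  qed
qed

text \<open>\<open>asucc a\<close> follows \<open>arev a\<close> on its face, so crossing the edge
  of \<open>a\<close> means turning to the next arc around the tail of \<open>a\<close>.\<close>

lemma sigma_succ:
  assumes a: "a \<in> arcs G - outer" and i: "i \<le> 2" "t (tail G a) \<noteq> i" "t (head G a) \<noteq> i"
  shows "sigma i (orbit \<phi> a) = (if asucc a \<in> outer then orbit \<phi> a else orbit \<phi> (asucc a))"
  using sigma_eq[OF assms] orbit_\<phi>[of "arev a"] \<phi>_in_outer_iff[of "arev a"] by simp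

text \<open>The chamber of \<open>asucc a\<close> contains \<open>arev a\<close>, the side opposite
  to the head of \<open>asucc a\<close>. Hence the reflection indexed by the type of that head
  crosses the edge of \<open>a\<close> backwards.\<close>

lemma sigma_pred:
  assumes a: "asucc a \<in> arcs G - outer"
  shows "sigma (t (head G (asucc a))) (orbit \<phi> (asucc a))
    = (if a \<in> outer then orbit \<phi> (asucc a) else orbit \<phi> a)"
proof -
  let ?b = "arev a" and ?i = "t (head G (asucc a))"
  have \<phi>b: "\<phi> ?b = asucc a" by simp
  have a': "a \<in> arcs G" "?b \<in> arcs G" "asucc a \<in> arcs G" using a by auto
  have b: "?b \<in> arcs G - outer" using a a' \<phi>_in_outer_iff[of ?b] by auto
  have "head G ?b = tail G (asucc a)" using a' by simp
  then have "t (head G ?b) \<noteq> ?i" using type_proper[OF a'(3)] by simp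
  moreover have "t (tail G ?b) \<noteq> ?i"
    using chamber(4)[OF b] tail_\<phi>[OF a'(3)] unfolding \<phi>b by simp
  ultimately show ?thesis
    using sigma_eq[OF b] type_le(2)[OF a'(3)] orbit_\<phi>[of ?b] unfolding \<phi>b by simp
qed

lemma sigma_chamber:
  assumes "C \<in> chambers" "i \<le> 2"
  shows "sigma i C \<in> chambers" and "sigma i (sigma i C) = C"
proof -
  obtain a0 where a0: "a0 \<in> arcs G - outer" "C = orbit \<phi> a0" "t (tail G a0) = i"
    using chamber_arc_exists[OF assms] by blast
  \<comment> \<open>As \<open>a0\<close> leaves the corner of type \<open>i\<close>, the next arc is
    the side opposite to it, the \<open>i\<close>-edge.\<close>
  let ?a = "\<phi> a0"
  have a0': "a0 \<in> arcs G" "?a \<in> arcs G" using a0 \<phi>_in_arcs by auto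
  have a: "?a \<in> arcs G - outer" "C = orbit \<phi> ?a"
    using a0 a0' \<phi>_in_outer_iff orbit_\<phi> by auto
  have i: "t (tail G ?a) \<noteq> i" "t (head G ?a) \<noteq> i"
    using chamber(3,4)[OF a0(1)] a0(3) tail_\<phi>[OF a0'(1)] tail_\<phi>[OF a0'(2)] by auto
  note s = sigma_eq[OF a(1) assms(2) i]
  show "sigma i C \<in> chambers"
    unfolding a(2) s using a a0' assms(1) by (auto simp: chambers_eq)
  show "sigma i (sigma i C) = C"
  proof (cases "arev ?a \<in> outer")
    case True
    then show ?thesis using s a(2) by simp
  next
    case False
    then have "arev ?a \<in> arcs G - outer" using a0' by simp
    then have "sigma i (orbit \<phi> (arev ?a)) = (if arev (arev ?a) \<in> outer then orbit \<phi> (arev ?a) else orbit \<phi> (arev (arev ?a)))"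
      by (rule sigma_eq[OF _ assms(2)]) (use i a0' in simp_all)
    then show ?thesis using s a False by simp
  qed
qed

section \<open>Chambers around a vertex and curvature\<close>

definition inner_arcs :: "'v \<Rightarrow> 'a set" where
  "inner_arcs v = out_arcs G v - outer"

lemma in_inner_arcs: "a \<in> inner_arcs v \<longleftrightarrow> a \<in> arcs G - outer \<and> tail G a = v"
  by (auto simp: inner_arcs_def)

lemma finite_inner_arcs [simp]: "finite (inner_arcs v)"
  by (simp add: inner_arcs_def finite_out_arcs)

lemma face_verts_outer_subset: "face_verts outer \<subseteq> verts G"
  using outer_subset_arcs by (auto simp: face_verts_def)

text \<open>The outer face leaves each of its vertices by exactly one arc, since
  \<open>tail G\<close> is injective on it.\<close>

lemma card_inner_arcs:
  shows "v \<notin> face_verts outer \<Longrightarrow> card (inner_arcs v) = out_degree G v"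
    and "v \<in> face_verts outer \<Longrightarrow> Suc (card (inner_arcs v)) = out_degree G v"
proof -
  assume "v \<notin> face_verts outer"
  then have "inner_arcs v = out_arcs G v" by (auto simp: inner_arcs_def face_verts_def)
  then show "card (inner_arcs v) = out_degree G v" by (simp add: out_degree_def)
next
  assume "v \<in> face_verts outer"
  then obtain b where b: "b \<in> outer" "tail G b = v" by (auto simp: face_verts_def)
  then have b': "b \<in> out_arcs G v" using outer_subset_arcs by auto
  have "b' = b" if "b' \<in> out_arcs G v \<inter> outer" for b'
    using that b by (intro inj_onD[OF inj_on_tail_outer]) auto
  then have "out_arcs G v = insert b (inner_arcs v)"
    unfolding inner_arcs_def using b' by blast
  moreover have "b \<notin> inner_arcs v" using b by (simp add: inner_arcs_def)
  ultimately show "Suc (card (inner_arcs v)) = out_degree G v" by (simp add: out_degree_def)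
qed

lemma card_inner_arcs_pos: "v \<in> verts G \<Longrightarrow> card (inner_arcs v) > 0"
  using two_le_card_out_arcs[OF two_connected _ loopfree, of v] card_inner_arcs[of v]
  by (cases "v \<in> face_verts outer") (auto simp: out_degree_def)

text \<open>Otherwise \<open>\<phi> a\<close> and \<open>arev a\<close> are outer arcs leaving the
  same vertex, hence equal, and that vertex has degree 1. Consequently every edge borders some
  chamber.\<close>

lemma not_both_outer:
  assumes "a \<in> arcs G" "a \<in> outer"
  shows "arev a \<notin> outer"
proof
  assume "arev a \<in> outer"
  then have "\<phi> a = arev a"
    using assms by (intro inj_onD[OF inj_on_tail_outer]) auto
  then have "asucc (arev a) = arev a" by (simp add: \<phi>_def)
  then have "orbit asucc (arev a) = {arev a}" by (simp add: orbit_eq_singleton_iff)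
  then have "inner_arcs (head G a) = {}"
    using \<open>arev a \<in> outer\<close> assms orbit_asucc[of "arev a"] by (simp add: inner_arcs_def)
  then show False using card_inner_arcs_pos[of "head G a"] assms by simp
qed

lemma inj_on_inner_arcs: "inj_on (orbit \<phi>) (inner_arcs v)"
  by (rule inj_onI) (use chamber_arc_unique in \<open>auto simp: in_inner_arcs\<close>)

lemma sigma_orbit_eq:
  assumes a: "a \<in> arcs G - outer"
    and ij: "i \<le> 2" "j \<le> 2" "i \<noteq> j" "t (tail G a) \<noteq> i" "t (tail G a) \<noteq> j"
  shows "sigma_orbit sigma {i, j} (orbit \<phi> a) = orbit \<phi> ` inner_arcs (tail G a)"
proof (intro equalityI)
  let ?v = "tail G a"
  show "sigma_orbit sigma {i, j} (orbit \<phi> a) \<subseteq> orbit \<phi> ` inner_arcs ?v"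
  proof (rule sigma_orbit_subsetI)
    show "orbit \<phi> a \<in> orbit \<phi> ` inner_arcs ?v" using a by (simp add: in_inner_arcs)
    fix l x assume l: "l \<in> {i, j}" and "x \<in> orbit \<phi> ` inner_arcs ?v"
    then obtain b where b: "b \<in> arcs G - outer" "tail G b = ?v" "x = orbit \<phi> b"
      by (auto simp: in_inner_arcs)
    show "sigma l x \<in> orbit \<phi> ` inner_arcs ?v"
    proof (cases "t (head G b) = l")
      case True
      obtain c where c: "b = asucc c" using permutes_surj[OF asucc_permutes] by (rule surjE)
      then have "c \<in> arcs G" "tail G c = ?v" using b by auto
      then show ?thesis
        using sigma_pred[of c] b True unfolding c by (auto simp: in_inner_arcs)
    next
      case False
      then have "sigma l x = (if asucc b \<in> outer then orbit \<phi> b else orbit \<phi> (asucc b))"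
        unfolding b(3) using b l ij by (intro sigma_succ) auto
      then show ?thesis using b by (auto simp: in_inner_arcs)
    qed
  qed
next
  let ?v = "tail G a"
  let ?X = "sigma_orbit sigma {i, j} (orbit \<phi> a)"
  show "orbit \<phi> ` inner_arcs ?v \<subseteq> ?X"
  proof
    fix x assume "x \<in> orbit \<phi> ` inner_arcs ?v"
    then obtain b where b: "b \<in> inner_arcs ?v" "x = orbit \<phi> b" by blast
    have "orbit \<phi> b \<in> ?X"
    \<comment> \<open>Removing the at most one outer arc from the rotation at the vertex leaves all
      its chambers connected by reflections.\<close>
    proof (rule cyclic_on_invariant[where P = "\<lambda>b. orbit \<phi> b \<in> ?X" and Z = outer and a = a])
      show "cyclic_on asucc (out_arcs G ?v)" using a by (intro cyclic_on_out_arcs) simp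
      show "a \<in> out_arcs G ?v - outer" using a by simp
      show "b \<in> out_arcs G ?v - outer" using b by (simp add: inner_arcs_def)
      show "orbit \<phi> a \<in> ?X" by (rule sigma_orbit_self)
      show "y = z" if "y \<in> out_arcs G ?v \<inter> outer" "z \<in> out_arcs G ?v \<inter> outer" for y z
        using that by (intro inj_onD[OF inj_on_tail_outer]) auto
      fix c assume c: "c \<in> out_arcs G ?v" "c \<notin> outer" "asucc c \<notin> outer"
      \<comment> \<open>The arc \<open>c\<close> ends in type \<open>i\<close> or \<open>j\<close>;
        the other index moves its chamber forward, and the head type of \<open>asucc c\<close>
        supplies the step back.\<close>
      obtain l where l: "l \<in> {i, j}" "l \<noteq> t (head G c)" using ij(3) by blast
      have s: "sigma l (orbit \<phi> c) = orbit \<phi> (asucc c)"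
        using c l ij by (subst sigma_succ) auto
      let ?l = "t (head G (asucc c))"
      have c': "asucc c \<in> arcs G - outer" using c by simp
      have "?l \<le> 2" "?l \<noteq> t ?v" "t ?v \<le> 2"
        using type_le[of "asucc c"] type_proper[of "asucc c"] c by auto
      then have "?l = i \<or> ?l = j" using ij by linarith
      then have "?l \<in> {i, j}" by simp
      moreover have "sigma ?l (orbit \<phi> (asucc c)) = orbit \<phi> c"
        using sigma_pred[OF c'] c by simp
      ultimately show "orbit \<phi> c \<in> ?X \<longleftrightarrow> orbit \<phi> (asucc c) \<in> ?X"
        using s l(1) sigma_orbit_step[of _ sigma "{i, j}"] by metis
    qed
    then show "x \<in> ?X" using b by simp
  qed
qed

section \<open>Values of \<open>m\<close> and periods of the rotations\<close>

lemma n_eq: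
  assumes "a \<in> arcs G - outer" "i \<le> 2" "j \<le> 2" "i \<noteq> j" "t (tail G a) \<noteq> i" "t (tail G a) \<noteq> j"
  shows "n i j (orbit \<phi> a) = card (inner_arcs (tail G a))"
  unfolding n_def sigma_orbit_eq[OF assms] using inj_on_inner_arcs by (rule card_image)

text \<open>The reciprocal of the factor by which \<open>m\<close> multiplies the orbit size;
  equivalently, the total of \<open>1 / m\<close> over the chambers with corner
  \<open>v\<close>.\<close>

definition weight :: "'v \<Rightarrow> real" where
  "weight v = (if v = v1 then 1/2 else if v = v0 then 1/3 else if v = v2 then 1/6
    else if v \<notin> face_verts outer then 2 else 1)"

lemma m_eq:
  assumes "a \<in> arcs G - outer" "i \<le> 2" "j \<le> 2" "i \<noteq> j" "t (tail G a) \<noteq> i" "t (tail G a) \<noteq> j"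
  shows "m i j (orbit \<phi> a) = card (inner_arcs (tail G a)) / weight (tail G a)"
  unfolding m_def corner_eq[OF assms] n_eq[OF assms] by (simp add: weight_def Let_def)

text \<open>The degree conditions on type 1 are made for this: 4 chambers halved at an inner vertex,
  3 - 1 = 2 at an ordinary outer one, and 2 - 1 = 1 doubled at \<open>v1\<close>.\<close>

lemma m02_eq:
  assumes "C \<in> chambers"
  shows "m 0 2 C = 2"
proof -
  obtain a where a: "a \<in> arcs G - outer" "C = orbit \<phi> a" "t (tail G a) = 1"
    using chamber_arc_exists[OF assms, of 1] by auto
  let ?v = "tail G a"
  have v: "?v \<in> verts G" "?v \<noteq> v0" "?v \<noteq> v2" using a type_v0 type_v2 by auto
  have "m 0 2 C = card (inner_arcs ?v) / weight ?v"
    unfolding a(2) using a by (intro m_eq) auto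
  also have "\<dots> = 2"
  proof (cases "?v \<in> face_verts outer")
    case True
    then have "Suc (card (inner_arcs ?v)) = out_degree G ?v" by (rule card_inner_arcs)
    moreover have "out_degree G ?v = (if ?v = v1 then 2 else 3)"
      using True a v type_v1 type1_outer[of ?v] by auto
    ultimately show ?thesis using True v by (auto simp: weight_def split: if_splits)
  next
    case False
    then have "card (inner_arcs ?v) = 4"
      using card_inner_arcs(1) type1_inner[OF v(1) a(3)] by simp
    moreover have "?v \<noteq> v1" using False special_outer by auto
    ultimately show ?thesis using False v by (simp add: weight_def)
  qed
  finally show ?thesis .
qed

text \<open>The heads of \<open>c\<close> and \<open>asucc c\<close> are two corners of the chamber
  containing \<open>arev c\<close>.\<close>

lemma head_type_alternates:
  assumes "c \<in> arcs G" "asucc c \<notin> outer"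
  shows "t (head G (asucc c)) \<noteq> t (head G c)"
proof -
  have b: "arev c \<in> arcs G - outer" using assms \<phi>_in_outer_iff[of "arev c"] by simp
  show ?thesis using chamber(4)[OF b] assms(1) by simp
qed

text \<open>The orbit size is always a period, so a weight \<open>1 / k\<close> merely multiplies it
  by \<open>k\<close>. Only weight 2, at an inner vertex, needs the orbit size to be even and half
  of it to be a period.\<close>

lemma rotation_period:
  assumes a: "a \<in> arcs G - outer"
    and ij: "i \<le> 2" "j \<le> 2" "i \<noteq> j" "t (tail G a) \<noteq> i" "t (tail G a) \<noteq> j"
  shows "\<exists>N>0. real N = m i j (orbit \<phi> a) \<and> ((\<lambda>x. sigma j (sigma i x)) ^^ N) (orbit \<phi> a) = orbit \<phi> a"
proof -
  let ?v = "tail G a" and ?C = "orbit \<phi> a" and ?\<rho> = "\<lambda>x. sigma j (sigma i x)"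
  define X where "X = sigma_orbit sigma {i, j} ?C"
  note X_eq = sigma_orbit_eq[OF assms, folded X_def]
  have X: "X \<subseteq> chambers" unfolding X_eq by (auto simp: in_inner_arcs chambers_eq)
  then have inv: "sigma l (sigma l x) = x" if "x \<in> X" "l \<le> 2" for x l
    using that sigma_chamber by blast
  have fin: "finite X" unfolding X_eq by simp
  have card: "card X = card (inner_arcs ?v)" unfolding X_eq using inj_on_inner_arcs by (rule card_image)
  have pos: "card X > 0" unfolding card using a by (intro card_inner_arcs_pos) auto
  note dih = dihedral_orbit[OF X_def fin inv[OF _ ij(1)] inv[OF _ ij(2)]]
  have m: "m i j ?C = card X / weight ?v" unfolding card by (rule m_eq[OF assms])
  have mult: ?thesis if "weight ?v = 1 / real k" "k > 0" for k
  proof (intro exI conjI)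
    show "card X * k > 0" using pos that by simp
    show "real (card X * k) = m i j ?C" using that m by simp
    have "(?\<rho> ^^ (card X * k')) ?C = ?C" for k'
      by (induction k') (use dih(1) in \<open>simp_all add: funpow_add\<close>)
    then show "(?\<rho> ^^ (card X * k)) ?C = ?C" .
  qed
  have "weight ?v = 1 / real 1 \<or> weight ?v = 1 / real 2 \<or> weight ?v = 1 / real 3
    \<or> weight ?v = 1 / real 6 \<or> weight ?v = 2 \<and> ?v \<notin> face_verts outer"
    by (simp add: weight_def)
  then consider "weight ?v = 1 / real 1" | "weight ?v = 1 / real 2" | "weight ?v = 1 / real 3"
    | "weight ?v = 1 / real 6" | "weight ?v = 2" "?v \<notin> face_verts outer"
    by blast
  then show ?thesis
  proof cases
    case 5
    \<comment> \<open>Colours a chamber by which of the types \<open>i\<close> and \<open>j\<close>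
      the head of its arc at \<open>?v\<close> has; neighbouring chambers around \<open>?v\<close>
      get different colours.\<close>
    define \<chi> where "\<chi> = (\<lambda>x. \<exists>b\<in>inner_arcs ?v. x = orbit \<phi> b \<and> t (head G b) = i)"
    have \<chi>: "\<chi> (orbit \<phi> b) \<longleftrightarrow> t (head G b) = i" if "b \<in> inner_arcs ?v" for b
      using that inj_onD[OF inj_on_inner_arcs, of b _ ?v] by (auto simp: \<chi>_def)
    have flip: "\<chi> (sigma l x) \<longleftrightarrow> \<not> \<chi> x" if x: "x \<in> X" and l: "l \<in> {i, j}" for x l
    proof -
      obtain b where b: "b \<in> inner_arcs ?v" "x = orbit \<phi> b" using x X_eq by auto
      have no_outer: "c \<notin> outer" if "tail G c = ?v" for c
        using 5(2) imageI[of c outer "tail G"] that by (auto simp: face_verts_def)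
      have b': "b \<in> arcs G - outer" "b \<in> arcs G" "tail G b = ?v"
        using b by (auto simp: in_inner_arcs)
      have *: "t (head G c) \<in> {i, j}" if "c \<in> arcs G" "tail G c = ?v" for c
      proof -
        have "t (head G c) = i \<or> t (head G c) = j"
          using type_le[OF that(1)] type_proper[OF that(1)] ij unfolding that(2) by linarith
        then show ?thesis by simp
      qed
      show ?thesis
      proof (cases "t (head G b) = l")
        case True
        obtain c where c: "b = asucc c" using permutes_surj[OF asucc_permutes] by (rule surjE)
        then have c': "c \<in> arcs G" "tail G c = ?v" using b' by auto
        then have "c \<in> inner_arcs ?v" using no_outer by (simp add: in_inner_arcs)
        moreover have "sigma l x = orbit \<phi> c"
          using sigma_pred[of c] b' no_outer[OF c'(2)] True unfolding b(2) c by simp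
        ultimately show ?thesis
          using \<chi>[of b] \<chi>[of c] b head_type_alternates[OF c'(1)] b' *[OF c'] *[OF b'(2,3)]
          unfolding c by auto
      next
        case False
        let ?c = "asucc b"
        have c': "?c \<in> arcs G" "tail G ?c = ?v" using b' by auto
        then have "?c \<in> inner_arcs ?v" using no_outer by (simp add: in_inner_arcs)
        moreover have "sigma l x = orbit \<phi> ?c"
          unfolding b(2) using b' l ij no_outer[OF c'(2)] False by (subst sigma_succ) auto
        ultimately show ?thesis
          using \<chi>[of b] \<chi>[of ?c] b head_type_alternates[OF b'(2)] no_outer[OF c'(2)] *[OF c'] *[OF b'(2,3)]
          by auto
      qed
    qed
    have "even (card X)" "(?\<rho> ^^ (card X div 2)) ?C = ?C"
      using dih(2)[of \<chi>] flip by blast+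
    moreover have "real (card X div 2) = m i j ?C"
      unfolding m 5(1) using \<open>even (card X)\<close> by (simp add: real_of_nat_div)
    ultimately show ?thesis using pos by (intro exI[of _ "card X div 2"]) (auto elim!: evenE)
  qed (rule mult, assumption, simp)+
qed

section \<open>Curvature and transitivity\<close>

lemma sum_inverse_m:
  assumes "i \<le> 2" "j \<le> 2" "k \<le> 2" "i \<noteq> j" "k \<noteq> i" "k \<noteq> j"
  shows "(\<Sum>C\<in>chambers. 1 / m i j C) = (\<Sum>v | v \<in> verts G \<and> t v = k. weight v)"
proof -
  let ?A = "{a \<in> arcs G - outer. t (tail G a) = k}"
  let ?h = "\<lambda>a. weight (tail G a) / card (inner_arcs (tail G a))"
  have "(\<Sum>C\<in>chambers. 1 / m i j C) = (\<Sum>a\<in>?A. 1 / m i j (orbit \<phi> a))"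
    by (rule sum.reindex_bij_betw[OF bij_betw_chambers[OF assms(3)], symmetric])
  also have "\<dots> = (\<Sum>a\<in>?A. ?h a)"
    by (rule sum.cong[OF refl], subst m_eq) (use assms in auto)
  also have "\<dots> = (\<Sum>v | v \<in> verts G \<and> t v = k. \<Sum>a | a \<in> ?A \<and> tail G a = v. ?h a)"
    by (rule sum.group[symmetric]) auto
  also have "\<dots> = (\<Sum>v | v \<in> verts G \<and> t v = k. weight v)"
  proof (rule sum.cong[OF refl])
    fix v assume v: "v \<in> {v \<in> verts G. t v = k}"
    have "(\<Sum>a | a \<in> ?A \<and> tail G a = v. ?h a) = (\<Sum>a\<in>inner_arcs v. weight v / card (inner_arcs v))"
      by (rule sum.cong) (use v in \<open>auto simp: in_inner_arcs\<close>)
    also have "\<dots> = weight v" using card_inner_arcs_pos[of v] v by auto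
    finally show "(\<Sum>a | a \<in> ?A \<and> tail G a = v. ?h a) = weight v" .
  qed
  finally show ?thesis .
qed

lemma sum_weight: "(\<Sum>v\<in>verts G. weight v) = 2 * real (card (verts G)) - real (card outer) - 2"
proof -
  have special: "v0 \<in> face_verts outer" "v1 \<in> face_verts outer" "v2 \<in> face_verts outer"
    using special_outer by auto
  then have in_verts: "v0 \<in> verts G" "v1 \<in> verts G" "v2 \<in> verts G"
    using face_verts_outer_subset by auto
  \<comment> \<open>The special vertices already lose 1 for being outer; 1/2, 2/3 and 5/6 are what
    remains from 1 down to 1/2, 1/3 and 1/6.\<close>
  have "weight v = 2 - (if v \<in> face_verts outer then 1 else 0) - (if v = v1 then 1/2 else 0)
      - (if v = v0 then 2/3 else 0) - (if v = v2 then 5/6 else 0)" for v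
    using special special_distinct by (auto simp: weight_def)
  then have "(\<Sum>v\<in>verts G. weight v) = 2 * real (card (verts G))
      - (\<Sum>v\<in>verts G. if v \<in> face_verts outer then 1 else 0) - 1/2 - 2/3 - 5/6"
    using in_verts by (simp add: sum_subtractf)
  also have "(\<Sum>v\<in>verts G. if v \<in> face_verts outer then 1 else 0) = real (card (face_verts outer))"
    using face_verts_outer_subset by (simp add: sum.If_cases Int_absorb1)
  also have "card (face_verts outer) = card outer"
    unfolding face_verts_def using inj_on_tail_outer by (rule card_image)
  finally show ?thesis by simp
qed

lemma card_arcs_chambers: "card (arcs G) = card outer + 3 * card chambers"
proof -
  let ?A = "\<lambda>k. {a \<in> arcs G - outer. t (tail G a) = k}"
  have "arcs G - outer = ?A 0 \<union> ?A 1 \<union> ?A 2"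
  proof (intro set_eqI)
    fix a show "a \<in> arcs G - outer \<longleftrightarrow> a \<in> ?A 0 \<union> ?A 1 \<union> ?A 2"
      using type_range[of "tail G a"] by auto
  qed
  also have "card \<dots> = card (?A 0) + card (?A 1) + card (?A 2)"
    by (subst card_Un_disjoint, force, force, force)+ simp
  also have "\<dots> = 3 * card chambers"
    using bij_betw_same_card[OF bij_betw_chambers, of 0] bij_betw_same_card[OF bij_betw_chambers, of 1]
      bij_betw_same_card[OF bij_betw_chambers, of 2] by simp
  finally have "card (arcs G - outer) = 3 * card chambers" .
  moreover have "card (arcs G - outer) = card (arcs G) - card outer"
    using outer_subset_arcs finite_subset[OF outer_subset_arcs] by (intro card_Diff_subset) auto
  moreover have "card outer \<le> card (arcs G)" using outer_subset_arcs by (intro card_mono) auto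
  ultimately show ?thesis by simp
qed

text \<open>The sum with all signs positive is the total weight, which equals the number of
  chambers; twice the sum of \<open>1 / m 0 2\<close> is the same number.\<close>

lemma curvature_zero: "(\<Sum>C\<in>chambers. 1 / m 0 1 C + 1 / m 1 2 C - 1 / m 0 2 C) = 0"
proof -
  have total: "(\<Sum>C\<in>chambers. 1 / m 0 1 C) + (\<Sum>C\<in>chambers. 1 / m 1 2 C) + (\<Sum>C\<in>chambers. 1 / m 0 2 C)
      = (\<Sum>v\<in>verts G. weight v)"
  proof -
    have "(\<Sum>v\<in>verts G. weight v) = (\<Sum>k\<in>{0, 1, 2}. \<Sum>v | v \<in> verts G \<and> t v = k. weight v)"
      by (rule sum.group[symmetric]) (use type_range in \<open>simp_all add: image_subset_iff\<close>)
    then show ?thesis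
      using sum_inverse_m[of 0 1 2] sum_inverse_m[of 1 2 0] sum_inverse_m[of 0 2 1] by simp
  qed
  have "faces = insert outer chambers" "outer \<notin> chambers"
    using outer_face by (auto simp: chambers_def)
  then have "card faces = Suc (card chambers)" using finite_chambers by simp
  \<comment> \<open>Combines V + F = E + 2 with F = c + 1 and 2E = |outer| + 3c for c
    chambers.\<close>
  then have "2 * card (verts G) = card outer + card chambers + 2"
    using euler_formula[OF plane] card_arcs card_arcs_chambers unfolding faces_eq by linarith
  then have "2 * real (card (verts G)) = real (card outer) + real (card chambers) + 2"
    by (metis (mono_tags) of_nat_add of_nat_mult of_nat_numeral)
  moreover have "(\<Sum>C\<in>chambers. 1 / m 0 2 C) = card chambers / 2" using m02_eq by simp
  ultimately show ?thesis
    using total sum_weight by (simp add: sum.distrib sum_subtractf)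
qed

text \<open>Reaching one chamber at a vertex means reaching all of them, by
  \<open>sigma_orbit_eq\<close>. A chamber contains both ends of each of its edges, so reachability
  spreads along edges through the connected graph.\<close>

lemma sigma_orbit_chambers:
  assumes "C \<in> chambers"
  shows "sigma_orbit sigma {0, 1, 2} C = chambers"
proof
  show "sigma_orbit sigma {0, 1, 2} C \<subseteq> chambers"
    by (rule sigma_orbit_subsetI) (use assms sigma_chamber in auto)
  let ?X = "sigma_orbit sigma {0, 1, 2} C"
  define P where "P v \<longleftrightarrow> (\<exists>a\<in>inner_arcs v. orbit \<phi> a \<in> ?X)" for v
  have around: "orbit \<phi> b \<in> ?X" if v: "P v" and b: "b \<in> inner_arcs v" for v b
  proof -
    obtain a where a: "a \<in> inner_arcs v" "orbit \<phi> a \<in> ?X" using v by (auto simp: P_def)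
    then have a': "a \<in> arcs G - outer" "tail G a = v" by (auto simp: in_inner_arcs)
    have "\<exists>i j. i \<le> 2 \<and> j \<le> 2 \<and> i \<noteq> j \<and> t v \<noteq> i \<and> t v \<noteq> (j::nat)"
      by presburger
    then obtain i j where ij: "i \<le> 2" "j \<le> 2" "i \<noteq> j" "t v \<noteq> i" "t v \<noteq> j" by blast
    have "orbit \<phi> b \<in> sigma_orbit sigma {i, j} (orbit \<phi> a)"
      using sigma_orbit_eq[OF a'(1) ij(1-3)] ij a' b by simp
    moreover have "sigma_orbit sigma {i, j} (orbit \<phi> a) \<subseteq> ?X"
    proof (rule sigma_orbit_subsetI)
      fix l x assume "l \<in> {i, j}" "x \<in> ?X"
      then show "sigma l x \<in> ?X" using ij by (intro sigma_orbit_step) auto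
    qed (rule a)
    ultimately show ?thesis by blast
  qed
  have half: "P (head G a)" if a: "a \<in> arcs G" "a \<notin> outer" "P (tail G a)" for a
    unfolding P_def
  proof
    show "\<phi> a \<in> inner_arcs (head G a)" using a by (simp add: in_inner_arcs)
    show "orbit \<phi> (\<phi> a) \<in> ?X" using around[OF a(3), of a] a by (simp add: in_inner_arcs)
  qed
  have half': "P (tail G a)" if a: "a \<in> arcs G" "a \<notin> outer" "P (head G a)" for a
    unfolding P_def
  proof
    show "a \<in> inner_arcs (tail G a)" using a by (simp add: in_inner_arcs)
    show "orbit \<phi> a \<in> ?X" using around[OF a(3), of "\<phi> a"] a by (simp add: in_inner_arcs)
  qed
  obtain c where c: "c \<in> arcs G - outer" "C = orbit \<phi> c" using assms chambers_eq by auto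
  show "chambers \<subseteq> ?X"
  proof
    fix D assume "D \<in> chambers"
    then obtain d where d: "d \<in> arcs G - outer" "D = orbit \<phi> d" using chambers_eq by auto
    have "P (tail G d)"
    proof (rule connected_invariant[OF connected])
      show "tail G c \<in> verts G" "tail G d \<in> verts G" using c d by auto
      show "P (tail G c)" unfolding P_def
        using c sigma_orbit_self[of C sigma] by (intro bexI[of _ c]) (auto simp: in_inner_arcs)
      fix a assume a: "a \<in> arcs G"
      show "P (tail G a) \<longleftrightarrow> P (head G a)"
      proof (cases "a \<in> outer")
        case True
        \<comment> \<open>An outer arc lies on no chamber, but its reverse does and joins the same
          two vertices.\<close>
        then have "arev a \<notin> outer" using not_both_outer a by simp
        then show ?thesis using half[of "arev a"] half'[of "arev a"] a by auto
      next
        case False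
        then show ?thesis using half half' a by blast
      qed
    qed
    then show "D \<in> ?X" using around[of "tail G d" d] d by (simp add: in_inner_arcs)
  qed
qed

lemma chambers_nonempty: "chambers \<noteq> {}"
proof -
  have "v0 \<in> verts G" using special_outer face_verts_outer_subset by auto
  then have "inner_arcs v0 \<noteq> {}" using card_inner_arcs_pos by fastforce
  then show ?thesis by (auto simp: in_inner_arcs chambers_eq)
qed

text \<open>By \<open>rotation_period\<close> the real values of \<open>m\<close> are positive
  integers for \<open>i < j \<le> 2\<close>, so taking the floor changes nothing.\<close>

lemma euclidean_symbol:
  defines "M \<equiv> \<lambda>i j C. nat \<lfloor>m i j C\<rfloor>"
  shows "i < j \<Longrightarrow> j \<le> 2 \<Longrightarrow> C \<in> chambers \<Longrightarrow> real (M i j C) = m i j C"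
    and "euclidean_delaney_dress_symbol chambers sigma M"
proof -
  have corner_arc: "\<exists>a. a \<in> arcs G - outer \<and> C = orbit \<phi> a \<and> t (tail G a) \<noteq> i \<and> t (tail G a) \<noteq> j"
    if "j \<le> 2" "C \<in> chambers" for i j C
  proof -
    have "\<exists>k\<le>2. k \<noteq> i \<and> k \<noteq> (j::nat)" by presburger
    then obtain k where "k \<le> 2" "k \<noteq> i" "k \<noteq> j" by blast
    then show ?thesis using chamber_arc_exists[OF that(2), of k] by metis
  qed
  have *: "M i j C > 0 \<and> real (M i j C) = m i j C \<and> ((\<lambda>x. sigma j (sigma i x)) ^^ M i j C) C = C"
    if ij: "i < j" "j \<le> 2" and C: "C \<in> chambers" for i j C
  proof -
    obtain a where a: "a \<in> arcs G - outer" "C = orbit \<phi> a" "t (tail G a) \<noteq> i" "t (tail G a) \<noteq> j"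
      using corner_arc[OF ij(2) C] by blast
    then obtain N where N: "N > 0" "real N = m i j C" "((\<lambda>x. sigma j (sigma i x)) ^^ N) C = C"
      using rotation_period[of a i j] ij by auto
    then have "M i j C = N" unfolding M_def N(2)[symmetric] by simp
    then show ?thesis using N by simp
  qed
  then show real_M: "\<And>i j C. i < j \<Longrightarrow> j \<le> 2 \<Longrightarrow> C \<in> chambers \<Longrightarrow> real (M i j C) = m i j C"
    by blast
  show "euclidean_delaney_dress_symbol chambers sigma M"
  proof
    show "sigma i C \<in> chambers" "sigma i (sigma i C) = C" if "i \<le> 2" "C \<in> chambers" for i C
      using sigma_chamber that by auto
    show "M i j C > 0" "((\<lambda>x. sigma j (sigma i x)) ^^ M i j C) C = C"
      if "i < j" "j \<le> 2" "C \<in> chambers" for i j C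
      using * that by blast+
    show "M 0 2 C = 2" if "C \<in> chambers" for C
      using m02_eq[OF that] by (simp add: M_def)
    show "finite chambers" by (rule finite_chambers)
    show "chambers \<noteq> {}" by (rule chambers_nonempty)
    show "sigma_orbit sigma {0, 1, 2} C = chambers" if "C \<in> chambers" for C
      using that by (rule sigma_orbit_chambers)
    show "M i j C' = M i j C"
      if ij: "i < j" "j \<le> 2" and C: "C \<in> chambers" and C': "C' \<in> sigma_orbit sigma {i, j} C" for i j C C'
    proof -
      obtain a where a: "a \<in> arcs G - outer" "C = orbit \<phi> a" "t (tail G a) \<noteq> i" "t (tail G a) \<noteq> j"
        using corner_arc[OF ij(2) C] by blast
      then have "C' \<in> orbit \<phi> ` inner_arcs (tail G a)"
        using C' sigma_orbit_eq[OF a(1), of i j] ij by simp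
      then obtain b where b: "b \<in> arcs G - outer" "tail G b = tail G a" "C' = orbit \<phi> b"
        by (auto simp: in_inner_arcs)
      then have "m i j C' = m i j C"
        using m_eq[OF a(1), of i j] m_eq[OF b(1), of i j] a ij by simp
      then show ?thesis by (simp add: M_def)
    qed
    show "(\<Sum>C\<in>chambers. 1 / real (M 0 1 C) + 1 / real (M 1 2 C) - 1 / real (M 0 2 C)) = 0"
      using curvature_zero real_M by simp
  qed
qed

end

theorem theorem3:
  fixes G :: "('v, 'a) pre_digraph" and arev asucc :: "'a \<Rightarrow> 'a"
    and t :: "'v \<Rightarrow> nat" and outer :: "'a set" and v0 v1 v2 :: 'v
  assumes "lsp_operation G arev asucc t outer v0 v1 v2"
  shows "\<exists>m :: nat \<Rightarrow> nat \<Rightarrow> 'a set \<Rightarrow> nat.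
    (\<forall>i j. i < j \<longrightarrow> j \<le> 2 \<longrightarrow> (\<forall>C \<in> lsp_operation.chambers G arev asucc outer.
       real (m i j C) = lsp_operation.m G arev asucc t outer v0 v1 v2 i j C)) \<and>
    euclidean_delaney_dress_symbol
      (lsp_operation.chambers G arev asucc outer)
      (lsp_operation.sigma G arev asucc t outer)
      m"
proof -
  interpret lsp_operation G arev asucc t outer v0 v1 v2 by (rule assms)
  show ?thesis
    by (rule exI[of _ "\<lambda>i j C. nat \<lfloor>m i j C\<rfloor>"]) (intro conjI allI impI ballI euclidean_symbol)
qed

end
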